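(* Let $H = T \cup C$ be a generalized Halin graph with characteristic tree $T$ and adjoint cycle $C$, and suppose $|C| \neq 5$. Then \[ \mathrm{ch}'_{\mathrm{star}}(H) \leq \max\left\{ \left\lfloor \frac{\theta(T) + \Delta(T)}{2} \right\rfloor,\ 2\left\lfloor \frac{\Delta(T)}{2} \right\rfloor + 7 \right\}, \] where $\theta(T) = \max_{xy \in E(T)} \{ d_T(x) + d_T(y) \}$.
   Context: All graphs are finite and simple. A star $k$-edge coloring of a graph $G$ is a proper edge coloring $\phi: E(G) \to \{1,\dots,k\}$ such that no path or cycle of length four (i.e. with four edges) in $G$ is bichromatic. Given a list assignment $L$ assigning a finite set $L(e)$ to each edge $e$, $G$ is star $k$-edge choosable if for every $L$ with $|L(e)| \geq k$ for all $e$ there is a star edge coloring $\varphi$ with $\varphi(e) \in L(e)$ for all $e$. The list star chromatic index $\mathrm{ch}'_{\mathrm{star}}(G)$ is the minimum such $k$. A generalized Halin graph $H = T \cup C$ is a plane graph consisting of a plane embedding of a tree $T$ (the characteristic tree) with $\Delta(T) \geq 3$ together with a cycle $C$ (the adjoint cycle) connecting all the leaves of $T$ such that $C$ is the boundary of the exterior face. $|C|$ denotes the length of $C$, and $d_T(x)$ the degree of $x$ in $T$. *)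

theory Defs
  imports "HOL-Analysis.Analysis"
begin

section \<open>Finite simple graphs\<close>

datatype 'a graph = Graph (verts: "'a set") (edges: "'a set set")

definition simple_graph :: "'a graph \<Rightarrow> bool" where
  "simple_graph G \<longleftrightarrow> finite (verts G) \<and> (\<forall>e\<in>edges G. e \<subseteq> verts G \<and> card e = 2)"

definition graph_union :: "'a graph \<Rightarrow> 'a graph \<Rightarrow> 'a graph" where
  "graph_union G H = Graph (verts G \<union> verts H) (edges G \<union> edges H)"

definition degree :: "'a graph \<Rightarrow> 'a \<Rightarrow> nat" where
  "degree G v = card {e \<in> edges G. v \<in> e}"

definition max_degree :: "'a graph \<Rightarrow> nat" where
  "max_degree G = Max (degree G ` verts G)"

definition max_edge_degree_sum :: "'a graph \<Rightarrow> nat" where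
  "max_edge_degree_sum G = Max {degree G x + degree G y | x y. {x, y} \<in> edges G}"

definition leaves :: "'a graph \<Rightarrow> 'a set" where
  "leaves G = {v \<in> verts G. degree G v = 1}"

text \<open>Walks, paths and cycles are given by vertex lists; a path on \<open>n + 1\<close> vertices and a
  cycle on \<open>n\<close> vertices have length \<open>n\<close>. The closing edge of a cycle joins its last vertex
  to its first.\<close>

definition walk :: "'a graph \<Rightarrow> 'a list \<Rightarrow> bool" where
  "walk G vs \<longleftrightarrow> vs \<noteq> [] \<and> set vs \<subseteq> verts G \<and> successively (\<lambda>x y. {x, y} \<in> edges G) vs"

definition path_in :: "'a graph \<Rightarrow> 'a list \<Rightarrow> bool" where
  "path_in G vs \<longleftrightarrow> walk G vs \<and> distinct vs"

definition cycle_in :: "'a graph \<Rightarrow> 'a list \<Rightarrow> bool" where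
  "cycle_in G vs \<longleftrightarrow> path_in G vs \<and> length vs \<ge> 3 \<and> {last vs, hd vs} \<in> edges G"

definition path_edges :: "'a list \<Rightarrow> 'a set set" where
  "path_edges vs = {{vs ! i, vs ! Suc i} | i. Suc i < length vs}"

definition cycle_edges :: "'a list \<Rightarrow> 'a set set" where
  "cycle_edges vs = insert {last vs, hd vs} (path_edges vs)"

definition connected_graph :: "'a graph \<Rightarrow> bool" where
  "connected_graph G \<longleftrightarrow> verts G \<noteq> {} \<and>
     (\<forall>u\<in>verts G. \<forall>v\<in>verts G. \<exists>vs. walk G vs \<and> hd vs = u \<and> last vs = v)"

definition tree :: "'a graph \<Rightarrow> bool" where
  "tree G \<longleftrightarrow> simple_graph G \<and> connected_graph G \<and> (\<nexists>vs. cycle_in G vs)"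

definition cycle_graph :: "'a graph \<Rightarrow> bool" where
  "cycle_graph G \<longleftrightarrow> (\<exists>vs. distinct vs \<and> length vs \<ge> 3 \<and> G = Graph (set vs) (cycle_edges vs))"


section \<open>Star edge colorings\<close>

definition proper_edge_coloring :: "'a graph \<Rightarrow> ('a set \<Rightarrow> nat) \<Rightarrow> bool" where
  "proper_edge_coloring G \<phi> \<longleftrightarrow>
     (\<forall>e\<in>edges G. \<forall>f\<in>edges G. e \<noteq> f \<and> e \<inter> f \<noteq> {} \<longrightarrow> \<phi> e \<noteq> \<phi> f)"

definition bichromatic :: "('a set \<Rightarrow> nat) \<Rightarrow> 'a set set \<Rightarrow> bool" where
  "bichromatic \<phi> F \<longleftrightarrow> card (\<phi> ` F) = 2"

definition star_edge_coloring :: "'a graph \<Rightarrow> ('a set \<Rightarrow> nat) \<Rightarrow> bool" where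
  "star_edge_coloring G \<phi> \<longleftrightarrow> proper_edge_coloring G \<phi> \<and>
     (\<forall>vs. path_in G vs \<and> length vs = 5 \<longrightarrow> \<not> bichromatic \<phi> (path_edges vs)) \<and>
     (\<forall>vs. cycle_in G vs \<and> length vs = 4 \<longrightarrow> \<not> bichromatic \<phi> (cycle_edges vs))"

text \<open>Colors are natural numbers. As lists are finite and graphs have finitely many edges, this
  is no restriction on the possible lists.\<close>

definition star_edge_choosable :: "'a graph \<Rightarrow> nat \<Rightarrow> bool" where
  "star_edge_choosable G k \<longleftrightarrow>
     (\<forall>L :: 'a set \<Rightarrow> nat set. (\<forall>e\<in>edges G. finite (L e) \<and> card (L e) \<ge> k) \<longrightarrow>
        (\<exists>\<phi>. star_edge_coloring G \<phi> \<and> (\<forall>e\<in>edges G. \<phi> e \<in> L e)))"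

definition list_star_chromatic_index :: "'a graph \<Rightarrow> nat" where
  "list_star_chromatic_index G = (LEAST k. star_edge_choosable G k)"

text \<open>The minimum above exists for every finite simple graph.\<close>

lemma injective_list_coloring:
  assumes "finite E" "\<And>e. e \<in> E \<Longrightarrow> finite (L e) \<and> card (L e) \<ge> card E"
  shows "\<exists>\<phi>. inj_on \<phi> E \<and> (\<forall>e\<in>E. \<phi> e \<in> (L e :: nat set))"
  using assms
proof (induction E rule: finite_induct)
  case empty
  then show ?case by simp
next
  case (insert x F)
  then obtain \<phi> where phi: "inj_on \<phi> F" "\<forall>e\<in>F. \<phi> e \<in> L e"
    by fastforce
  have "card (\<phi> ` F) < card (L x)"
    using insert card_image_le[of F \<phi>] by fastforce
  then obtain c where c: "c \<in> L x" "c \<notin> \<phi> ` F"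
    using insert.hyps(1) by (metis card_mono finite_imageI leD subsetI)
  have "inj_on (\<phi>(x := c)) (insert x F) \<and> (\<forall>e\<in>insert x F. (\<phi>(x := c)) e \<in> L e)"
    using phi c insert.hyps(2) by (auto simp: inj_on_def)
  then show ?case by blast
qed

lemma path_edges_subset: "walk G vs \<Longrightarrow> path_edges vs \<subseteq> edges G"
  by (auto simp: walk_def path_edges_def successively_conv_nth)

lemma injective_star_edge_coloring:
  assumes inj: "inj_on \<phi> (edges G)"
  shows "star_edge_coloring G \<phi>"
proof -
  have three: False
    if F: "F \<subseteq> edges G" "bichromatic \<phi> F" "{a, b} \<in> F" "{b, c} \<in> F" "{c, d} \<in> F"
      and "distinct [a, b, c, d]" for F a b c d
  proof -
    have "card F = 2"
      using F inj by (metis bichromatic_def card_image inj_on_subset)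
    moreover have "card {{a, b}, {b, c}, {c, d}} = 3"
      using that(6) by (auto simp: doubleton_eq_iff)
    moreover have "{{a, b}, {b, c}, {c, d}} \<subseteq> F"
      using F by auto
    ultimately show False
      by (metis card.infinite card_mono numeral_le_iff semiring_norm(72) zero_neq_numeral
          numeral_less_iff not_le lessI numeral_2_eq_2 numeral_3_eq_3)
  qed
  have ends: False
    if "path_in G vs" "length vs \<ge> 4" "path_edges vs \<subseteq> F" "F \<subseteq> edges G" "bichromatic \<phi> F" for vs F
  proof -
    have e: "{vs ! i, vs ! Suc i} \<in> F" if "i < 3" for i
      using that \<open>length vs \<ge> 4\<close> \<open>path_edges vs \<subseteq> F\<close> by (fastforce simp: path_edges_def)
    have "vs ! i \<noteq> vs ! j" if "i < j" "j < 4" for i j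
      using that \<open>path_in G vs\<close> \<open>length vs \<ge> 4\<close> by (simp add: path_in_def nth_eq_iff_index_eq)
    then have "distinct [vs ! 0, vs ! 1, vs ! 2, vs ! 3]"
      by simp
    then show False
      using three[OF that(4,5), of "vs ! 0" "vs ! 1" "vs ! 2" "vs ! 3"] e[of 0] e[of 1] e[of 2]
      by (simp add: eval_nat_numeral)
  qed
  show ?thesis
    unfolding star_edge_coloring_def
  proof (intro conjI allI impI notI)
    show "proper_edge_coloring G \<phi>"
      using inj by (auto simp: proper_edge_coloring_def inj_on_def)
  next
    fix vs assume "path_in G vs \<and> length vs = 5" "bichromatic \<phi> (path_edges vs)"
    then show False
      using ends[of vs "path_edges vs"] path_edges_subset[of G vs] by (auto simp: path_in_def)
  next
    fix vs assume "cycle_in G vs \<and> length vs = 4" "bichromatic \<phi> (cycle_edges vs)"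
    then show False
      using ends[of vs "cycle_edges vs"] path_edges_subset[of G vs]
      by (auto simp: cycle_in_def cycle_edges_def path_in_def)
  qed
qed

lemma star_edge_choosable_card_edges:
  assumes "simple_graph G"
  shows "star_edge_choosable G (card (edges G))"
proof -
  have "edges G \<subseteq> Pow (verts G)" "finite (verts G)"
    using assms by (auto simp: simple_graph_def)
  then have "finite (edges G)"
    by (meson finite_Pow_iff finite_subset)
  then show ?thesis
    unfolding star_edge_choosable_def
    using injective_list_coloring injective_star_edge_coloring by metis
qed


section \<open>Plane graphs and generalized Halin graphs\<close>

text \<open>A plane graph is a graph \<open>G\<close> drawn in the plane: \<open>p\<close> places the vertices, and each edge
  \<open>e\<close> is drawn as the simple arc \<open>\<gamma> e\<close>. Arcs contain no vertices besides their endpoints and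
  meet only in common endpoints.\<close>

definition plane_graph :: "'a graph \<Rightarrow> ('a \<Rightarrow> complex) \<Rightarrow> ('a set \<Rightarrow> real \<Rightarrow> complex) \<Rightarrow> bool" where
  "plane_graph G p \<gamma> \<longleftrightarrow> simple_graph G \<and> inj_on p (verts G) \<and>
     (\<forall>e\<in>edges G. arc (\<gamma> e) \<and> {pathstart (\<gamma> e), pathfinish (\<gamma> e)} = p ` e) \<and>
     (\<forall>e\<in>edges G. \<forall>v\<in>verts G. p v \<in> path_image (\<gamma> e) \<longrightarrow> v \<in> e) \<and>
     (\<forall>e\<in>edges G. \<forall>f\<in>edges G. e \<noteq> f \<longrightarrow> path_image (\<gamma> e) \<inter> path_image (\<gamma> f) = p ` (e \<inter> f))"

definition drawing :: "'a graph \<Rightarrow> ('a \<Rightarrow> complex) \<Rightarrow> ('a set \<Rightarrow> real \<Rightarrow> complex) \<Rightarrow> complex set" where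
  "drawing G p \<gamma> = p ` verts G \<union> (\<Union>e\<in>edges G. path_image (\<gamma> e))"

text \<open>The drawing is compact, so its \<open>outside\<close> is the unique unbounded component of its
  complement.\<close>

definition exterior_face :: "'a graph \<Rightarrow> ('a \<Rightarrow> complex) \<Rightarrow> ('a set \<Rightarrow> real \<Rightarrow> complex) \<Rightarrow> complex set" where
  "exterior_face G p \<gamma> = outside (drawing G p \<gamma>)"

definition generalized_halin ::
    "'a graph \<Rightarrow> 'a graph \<Rightarrow> ('a \<Rightarrow> complex) \<Rightarrow> ('a set \<Rightarrow> real \<Rightarrow> complex) \<Rightarrow> bool" where
  "generalized_halin T C p \<gamma> \<longleftrightarrow>
     tree T \<and> max_degree T \<ge> 3 \<and>
     cycle_graph C \<and> verts C = leaves T \<and>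
     plane_graph (graph_union T C) p \<gamma> \<and>
     frontier (exterior_face (graph_union T C) p \<gamma>) = drawing C p \<gamma>"

end

theory Submission
  imports Defs
begin

text \<open>The tree \<open>T\<close> is coloured first, vertex by vertex, and the cycle \<open>C\<close> afterwards.

  To avoid bichromatic paths centred at a vertex \<open>v\<close> of \<open>T\<close>, choose a tournament on the neighbours of
  \<open>v\<close> in which all out-degrees are at most \<open>\<lfloor>d(v)/2\<rfloor>\<close>; an arc from \<open>y\<close> to \<open>z\<close> forbids the colour of
  \<open>vz\<close> at \<open>y\<close>. When a vertex \<open>w\<close> with coloured edge \<open>vw\<close> is reached, its other edges must avoid the
  colour of \<open>vw\<close> and \<open>\<lfloor>d(v)/2\<rfloor>\<close> further colours, which leaves \<open>k - 1 - \<lfloor>d(v)/2\<rfloor> \<ge> d(w) - 1\<close> colours,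
  and \<open>\<lfloor>d(w)/2\<rfloor>\<close> of these edges are made to avoid all colours at \<open>v\<close>, so that a circulant tournament at \<open>w\<close>
  is compatible with the edges already coloured.

  In addition, the tree edges at consecutive vertices of \<open>C\<close> get different colours. Planarity enters
  here only: by the Jordan curve theorem, two leaf neighbours of \<open>w\<close> split the remaining leaves into
  two arcs of \<open>C\<close> that are not connected in \<open>T - w\<close>, so at most two leaf neighbours of \<open>w\<close> have a
  neighbour on \<open>C\<close> whose tree edge is coloured before.

  An edge of \<open>C\<close> finally avoids the colours of four tree edges at leaves and twice at most \<open>\<lfloor>\<Delta>/2\<rfloor>\<close>
  colours forbidden by the tournaments, so three colours remain, and cycles of length other than 5
  are star 3-edge choosable.\<close>

section \<open>Arcs and separation in plane graphs\<close>

lemma path_edges_Nil [simp]: "path_edges [] = {}"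
  and path_edges_single [simp]: "path_edges [a] = {}"
  by (auto simp: path_edges_def)

lemma path_edges_Cons [simp]: "path_edges (a # b # vs) = insert {a, b} (path_edges (b # vs))"
proof (intro equalityI subsetI)
  fix e assume "e \<in> path_edges (a # b # vs)"
  then obtain i where "e = {(a # b # vs) ! i, (a # b # vs) ! Suc i}" "Suc i < length (a # b # vs)"
    by (auto simp: path_edges_def)
  then show "e \<in> insert {a, b} (path_edges (b # vs))"
    by (cases i) (auto simp: path_edges_def)
next
  fix e assume "e \<in> insert {a, b} (path_edges (b # vs))"
  then consider "e = {a, b}" | i where "e = {(b # vs) ! i, (b # vs) ! Suc i}" "Suc i < length (b # vs)"
    by (auto simp: path_edges_def)
  then show "e \<in> path_edges (a # b # vs)"
  proof cases
    case 1
    then show ?thesis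
      unfolding path_edges_def by (intro CollectI exI[of _ 0]) auto
  next
    case 2
    then show ?thesis
      unfolding path_edges_def by (intro CollectI exI[of _ "Suc i"]) auto
  qed
qed

lemma path_edges_append:
  "xs \<noteq> [] \<Longrightarrow> ys \<noteq> [] \<Longrightarrow>
    path_edges (xs @ ys) = insert {last xs, hd ys} (path_edges xs \<union> path_edges ys)"
proof (induction xs)
  case (Cons x xs)
  then show ?case
    by (cases xs; cases ys) (auto simp: insert_commute)
qed simp

lemma path_edges_split: "path_edges (xs @ y # ys) = path_edges (xs @ [y]) \<union> path_edges (y # ys)"
proof (induction xs)
  case (Cons x xs)
  then show ?case
    by (cases xs) auto
qed simp

lemma path_inI:
  assumes "distinct vs" "vs \<noteq> []" "set vs \<subseteq> verts G" "path_edges vs \<subseteq> edges G"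
  shows "path_in G vs"
  using assms by (auto simp: path_in_def walk_def path_edges_def successively_conv_nth)

lemma Union_path_edges_subset: "\<Union>(path_edges vs) \<subseteq> set vs"
  by (auto simp: path_edges_def)

text \<open>An inner edge joining the two ends would need 0 and \<open>length vs - 1\<close> to be
  adjacent positions. This later keeps the two arcs of a cycle between two vertices free of common
  edges.\<close>

lemma path_edges_ends:
  assumes "distinct vs" "length vs \<ge> 3"
  shows "{hd vs, last vs} \<notin> path_edges vs"
proof
  assume "{hd vs, last vs} \<in> path_edges vs"
  then obtain i where i: "{vs ! 0, vs ! (length vs - 1)} = {vs ! i, vs ! Suc i}" "Suc i < length vs"
    using hd_conv_nth[of vs] last_conv_nth[of vs] assms(2) by (force simp: path_edges_def)
  have "vs \<noteq> []" using assms by auto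
  with i assms show False
    by (auto simp: doubleton_eq_iff nth_eq_iff_index_eq)
qed

text \<open>Induction along the path: the arc of the first edge meets the rest only in the second
  vertex, as the first vertex lies on no later edge. Two vertices are required because a single
  point is not an arc.\<close>

lemma plane_graph_arc:
  assumes "plane_graph G p \<gamma>" "path_in G vs" "length vs \<ge> 2"
  shows "\<exists>g. arc g \<and> pathstart g = p (hd vs) \<and> pathfinish g = p (last vs) \<and>
    path_image g = (\<Union>e\<in>path_edges vs. path_image (\<gamma> e))"
  using assms(2,3)
proof (induction vs)
  case (Cons a vs)
  then obtain b us where vs: "vs = b # us"
    by (cases vs) auto
  have ab: "{a, b} \<in> edges G" and bus: "path_in G (b # us)"
    and a: "a \<notin> set (b # us)"
    using Cons.prems vs by (auto simp: path_in_def walk_def)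
  have "arc (\<gamma> {a, b})" "{pathstart (\<gamma> {a, b}), pathfinish (\<gamma> {a, b})} = {p a, p b}"
    using assms(1) ab by (auto simp: plane_graph_def)
  \<comment> \<open>An edge has no orientation, so its arc may have to be reversed to start at
    \<open>a\<close>.\<close>
  then obtain g1 where g1: "arc g1" "pathstart g1 = p a" "pathfinish g1 = p b"
    "path_image g1 = path_image (\<gamma> {a, b})"
    by (cases "pathstart (\<gamma> {a, b}) = p a")
       (auto simp: doubleton_eq_iff intro: that[of "\<gamma> {a, b}"] that[of "reversepath (\<gamma> {a, b})"]
          arc_reversepath)
  show ?case
  proof (cases us)
    case Nil
    then show ?thesis using g1 vs by auto
  next
    case (Cons c ws)
    then obtain g2 where g2: "arc g2" "pathstart g2 = p b" "pathfinish g2 = p (last us)"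
      "path_image g2 = (\<Union>e\<in>path_edges (b # us). path_image (\<gamma> e))"
      using Cons.IH bus vs by auto
    have "path_image (\<gamma> {a, b}) \<inter> path_image (\<gamma> e) \<subseteq> {p b}" if e: "e \<in> path_edges (b # us)" for e
    proof -
      have "e \<in> edges G"
        using e path_edges_subset bus by (auto simp: path_in_def)
      moreover have "a \<notin> e"
        using a e Union_path_edges_subset by fast
      ultimately have "path_image (\<gamma> {a, b}) \<inter> path_image (\<gamma> e) = p ` ({a, b} \<inter> e)"
        using assms(1) ab unfolding plane_graph_def by (metis insertI1)
      also have "\<dots> \<subseteq> {p b}" using \<open>a \<notin> e\<close> by auto
      finally show ?thesis .
    qed
    then have "path_image g1 \<inter> path_image g2 \<subseteq> {pathstart g2}"
      using g1 g2 by auto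
    then have "arc (g1 +++ g2)" using g1 g2 by (intro arc_join) auto
    then show ?thesis
      using g1 g2 vs Cons
      by (intro exI[of _ "g1 +++ g2"]) (auto simp: path_image_join)
  qed
qed simp

text \<open>The vertex points are included besides the edges so that a walk with one vertex has a
  nonempty drawing.\<close>

lemma plane_graph_walk_connected:
  assumes "plane_graph G p \<gamma>" "walk G vs"
  shows "connected (p ` set vs \<union> (\<Union>e\<in>path_edges vs. path_image (\<gamma> e)))"
  using assms(2)
proof (induction vs)
  case (Cons a vs)
  show ?case
  proof (cases vs)
    case (Cons b us)
    let ?X = "p ` set vs \<union> (\<Union>e\<in>path_edges vs. path_image (\<gamma> e))"
    have ab: "{a, b} \<in> edges G" and "walk G vs"
      using Cons.prems Cons by (auto simp: walk_def)
    then have "connected ?X" using Cons.IH by blast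
    moreover have e: "arc (\<gamma> {a, b})" "{pathstart (\<gamma> {a, b}), pathfinish (\<gamma> {a, b})} = {p a, p b}"
      using assms(1) ab by (auto simp: plane_graph_def)
    moreover have ends: "p a \<in> path_image (\<gamma> {a, b})" "p b \<in> path_image (\<gamma> {a, b})"
      using e(2) pathstart_in_path_image[of "\<gamma> {a, b}"] pathfinish_in_path_image[of "\<gamma> {a, b}"]
      by (auto simp: doubleton_eq_iff)
    moreover have "path_image (\<gamma> {a, b}) \<inter> ?X \<noteq> {}"
      using ends Cons by auto
    ultimately have "connected (path_image (\<gamma> {a, b}) \<union> ?X)"
      by (metis connected_Un connected_arc_image)
    moreover have "path_image (\<gamma> {a, b}) \<union> ?X
        = p ` set (a # vs) \<union> (\<Union>e\<in>path_edges (a # vs). path_image (\<gamma> e))"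
      using Cons ends by auto
    ultimately show ?thesis by simp
  qed simp
qed (simp add: walk_def)

lemma plane_graph_Int:
  assumes "plane_graph G p \<gamma>" "E \<subseteq> edges G" "F \<subseteq> edges G" "E \<inter> F = {}"
  shows "(\<Union>e\<in>E. path_image (\<gamma> e)) \<inter> (\<Union>f\<in>F. path_image (\<gamma> f)) \<subseteq> p ` (\<Union>E \<inter> \<Union>F)"
proof
  fix z assume "z \<in> (\<Union>e\<in>E. path_image (\<gamma> e)) \<inter> (\<Union>f\<in>F. path_image (\<gamma> f))"
  then obtain e f where ef: "e \<in> E" "f \<in> F" "z \<in> path_image (\<gamma> e) \<inter> path_image (\<gamma> f)"
    by auto
  then have "path_image (\<gamma> e) \<inter> path_image (\<gamma> f) = p ` (e \<inter> f)"
    using assms unfolding plane_graph_def by (metis disjoint_iff subsetD)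
  with ef show "z \<in> p ` (\<Union>E \<inter> \<Union>F)" by blast
qed

text \<open>\<open>outside J\<close> is connected, meets \<open>outside D\<close> and avoids its
  frontier \<open>J\<close>, so it cannot leave \<open>outside D\<close>.\<close>

lemma outside_eq_if_frontier:
  fixes D J :: "complex set"
  assumes "compact D" "compact J" "J \<subseteq> D" "frontier (outside D) = J"
  shows "outside J = outside D"
proof
  show "outside D \<subseteq> outside J" using assms(3) by (rule outside_mono)
  have "connected (outside J)"
    using assms(2) by (simp add: compact_imp_bounded connected_outside)
  moreover have "outside J \<inter> outside D \<noteq> {}"
    using \<open>outside D \<subseteq> outside J\<close> unbounded_outside[of D] assms(1)
    by (metis bounded_empty compact_imp_bounded inf.absorb_iff2)
  moreover have "outside J \<inter> frontier (outside D) = {}"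
    using assms(4) outside_no_overlap by auto
  ultimately show "outside J \<subseteq> outside D"
    using connected_Int_frontier by blast
qed

lemma Union_path_edges: "length vs \<ge> 2 \<Longrightarrow> \<Union>(path_edges vs) = set vs"
proof (induction vs)
  case (Cons a vs)
  then obtain b us where "vs = b # us"
    by (cases vs) auto
  with Cons show ?case
    by (cases us) auto
qed simp

lemma plane_graph_vertex_on_edge:
  assumes "plane_graph G p \<gamma>" "e \<in> edges G" "v \<in> verts G"
  shows "p v \<in> path_image (\<gamma> e) \<longleftrightarrow> v \<in> e"
proof
  assume "v \<in> e"
  then have "p v \<in> {pathstart (\<gamma> e), pathfinish (\<gamma> e)}"
    using assms unfolding plane_graph_def by blast
  then show "p v \<in> path_image (\<gamma> e)"
    by (auto simp: pathstart_in_path_image pathfinish_in_path_image)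
qed (use assms in \<open>auto simp: plane_graph_def\<close>)

text \<open>The adjoint cycle and the chord \<open>x\<close>, \<open>w\<close>, \<open>y\<close>
  form a theta curve. The chord cuts the inside of the cycle into two regions, one for the arc
  through \<open>B\<close> and one for the arc through \<open>D\<close> and \<open>A\<close>. The
  drawing of a walk that avoids the chord is connected, so it cannot touch both arcs.\<close>

lemma halin_noncrossing:
  assumes H: "generalized_halin T C p \<gamma>"
    and C: "C = Graph (set cs) (cycle_edges cs)" "distinct cs"
    and cs: "cs = A @ x # B @ y # D"
    and w: "w \<in> verts T" "w \<notin> set cs" "{w, x} \<in> edges T" "{w, y} \<in> edges T"
    and ws: "walk T ws" "set ws \<inter> {w, x, y} = {}" "hd ws \<in> set B" "last ws \<in> set (A @ D)"
  shows False
proof -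
  define G where "G = graph_union T C"
  define V where "V = p ` set ws \<union> (\<Union>e\<in>path_edges ws. path_image (\<gamma> e))"
  let ?E1 = "path_edges (x # B @ [y])" and ?E2 = "path_edges (y # D @ A @ [x])"
    and ?E = "path_edges [x, w, y]"
  have pg: "plane_graph G p \<gamma>" and fr: "frontier (outside (drawing G p \<gamma>)) = drawing C p \<gamma>"
    and sT: "simple_graph T" and leaves: "verts C = leaves T"
    using H by (auto simp: generalized_halin_def G_def exterior_face_def tree_def)
  have EG: "edges G = edges T \<union> cycle_edges cs" and VG: "verts G = verts T"
    using leaves by (auto simp: G_def graph_union_def C leaves_def)
  have B: "B \<noteq> []" and DA: "D @ A \<noteq> []" and "ws \<noteq> []"
    using ws by (auto simp: walk_def)
  \<comment> \<open>\<open>x\<close> and \<open>y\<close> cut the closed list \<open>cs\<close> into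
    two paths; the second runs through the closing edge.\<close>
  have E12: "?E1 \<union> ?E2 = cycle_edges cs"
  proof -
    have "path_edges (x # B @ y # D) = ?E1 \<union> path_edges (y # D)"
      using path_edges_split[of "x # B" y D] by simp
    moreover have "?E2 = insert {last (y # D), hd (A @ [x])} (path_edges (y # D) \<union> path_edges (A @ [x]))"
      using path_edges_append[of "y # D" "A @ [x]"] by simp
    moreover have "hd cs = hd (A @ [x])" "last cs = last (y # D)"
      using cs by (auto simp: hd_append)
    ultimately show ?thesis
      unfolding cycle_edges_def using path_edges_split[of A x "B @ y # D"] cs by auto
  qed
  have sG: "simple_graph G" using pg by (simp add: plane_graph_def)
  have csV: "set cs \<subseteq> verts T"
    using leaves by (auto simp: C leaves_def)
  have dist: "distinct (x # B @ [y])" "distinct (y # D @ A @ [x])"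
    using C(2) cs by auto
  have U1: "\<Union>?E1 = insert x (insert y (set B))"
    using Union_path_edges[of "x # B @ [y]"] by auto
  have U2: "\<Union>?E2 = insert x (insert y (set (D @ A)))"
    using Union_path_edges[of "y # D @ A @ [x]"] by auto
  have U: "\<Union>?E = {x, w, y}" by auto
  have UU: "\<Union>?E1 \<inter> \<Union>?E2 = {x, y}" "\<Union>?E1 \<inter> \<Union>?E = {x, y}" "\<Union>?E2 \<inter> \<Union>?E = {x, y}"
    unfolding U1 U2 U using dist w(2) cs C(2) by auto
  have sub: "?E1 \<subseteq> edges G" "?E2 \<subseteq> edges G" "?E \<subseteq> edges G"
    using E12 w EG by (auto simp: insert_commute)
  have card2: "card e = 2" if "e \<in> edges G" for e
    using sG that by (auto simp: simple_graph_def)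
  \<comment> \<open>A common edge could only be \<open>{x, y}\<close>, but \<open>B\<close> is
    nonempty, so this edge does not occur on the first path.\<close>
  have E12d: "?E1 \<inter> ?E2 = {}"
  proof (rule ccontr)
    assume "?E1 \<inter> ?E2 \<noteq> {}"
    then obtain e where e: "e \<in> ?E1" "e \<in> ?E2" by auto
    then have "e \<subseteq> {x, y}" using UU(1) by blast
    moreover have "card e = 2" using e sub card2 by blast
    moreover have "card {x, y} \<le> 2" by (simp add: card_insert_if)
    ultimately have "e = {x, y}"
      by (metis card_seteq finite.emptyI finite.insertI)
    then show False
      using path_edges_ends[OF dist(1)] e B by (cases B) auto
  qed
  have wE: "w \<notin> \<Union>?E1" "w \<notin> \<Union>?E2"
    using U1 U2 w(2,3,4) cs by (auto simp: C)
  then have E1d: "?E1 \<inter> ?E = {}" and E2d: "?E2 \<inter> ?E = {}"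
    by auto
  have "path_in G (x # B @ [y])" "path_in G (y # D @ A @ [x])" "path_in G [x, w, y]"
    using dist sub csV cs w by (auto intro!: path_inI simp del: path_edges_Cons simp: VG)
  then obtain c1 c2 c where c1: "arc c1" "pathstart c1 = p x" "pathfinish c1 = p y"
      "path_image c1 = (\<Union>e\<in>?E1. path_image (\<gamma> e))"
    and c2: "arc c2" "pathstart c2 = p y" "pathfinish c2 = p x"
      "path_image c2 = (\<Union>e\<in>?E2. path_image (\<gamma> e))"
    and c: "arc c" "pathstart c = p x" "pathfinish c = p y"
      "path_image c = (\<Union>e\<in>?E. path_image (\<gamma> e))"
    using plane_graph_arc[OF pg, of "x # B @ [y]"] plane_graph_arc[OF pg, of "y # D @ A @ [x]"]
      plane_graph_arc[OF pg, of "[x, w, y]"] by (auto simp del: path_edges_Cons)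
  define J where "J = path_image c1 \<union> path_image c2"
  have cyc: "e \<subseteq> set cs" if "e \<in> cycle_edges cs" for e
  proof -
    have "e \<subseteq> \<Union>?E1 \<union> \<Union>?E2" using that E12 by blast
    then show ?thesis using U1 U2 cs by auto
  qed
  have J': "J = (\<Union>e\<in>cycle_edges cs. path_image (\<gamma> e))"
    unfolding J_def c1(4) c2(4) E12[symmetric] by blast
  have J: "J = drawing C p \<gamma>"
  proof -
    have "p v \<in> J" if "v \<in> set cs" for v
    proof -
      have "v \<in> \<Union>?E1 \<union> \<Union>?E2" using U1 U2 cs that by auto
      then obtain e where "e \<in> cycle_edges cs" "v \<in> e" using E12 by blast
      then show ?thesis
        using plane_graph_vertex_on_edge[OF pg, of e v] csV that unfolding J' EG VG by auto
    qed
    then show ?thesis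
      unfolding drawing_def C J'[symmetric] by (auto simp: J')
  qed
  have DG: "drawing C p \<gamma> \<subseteq> drawing G p \<gamma>"
    by (auto simp: drawing_def G_def graph_union_def)
  have cJ: "compact J"
    using c1(1) c2(1) by (auto simp: J_def compact_arc_image)
  have "edges G \<subseteq> Pow (verts G)" "finite (verts G)"
    using sG by (auto simp: simple_graph_def)
  then have "finite (edges G)"
    by (meson finite_Pow_iff finite_subset)
  then have cD: "compact (drawing G p \<gamma>)"
    using pg \<open>finite (verts G)\<close> unfolding drawing_def plane_graph_def
    by (intro compact_Un compact_UN) (auto simp: compact_arc_image finite_imp_compact)
  \<comment> \<open>Here the frontier condition of a generalized Halin graph enters: the exterior
    face is the outside of \<open>J\<close>, hence everything drawn lies on or inside the
    cycle.\<close>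
  have "outside J = outside (drawing G p \<gamma>)"
    using outside_eq_if_frontier[OF cD cJ] fr J DG by auto
  then have "drawing G p \<gamma> \<inter> outside J = {}"
    using outside_no_overlap by blast
  then have DJ: "drawing G p \<gamma> \<subseteq> J \<union> inside J"
    using inside_Un_outside[of J] by blast
  have ends: "path_image c1 \<inter> path_image c2 = {p x, p y}"
    "path_image c1 \<inter> path_image c = {p x, p y}" "path_image c2 \<inter> path_image c = {p x, p y}"
  proof -
    have "p x \<in> path_image c1" "p y \<in> path_image c1" "p x \<in> path_image c2" "p y \<in> path_image c2"
      "p x \<in> path_image c" "p y \<in> path_image c"
      using c1(2,3) c2(2,3) c(2,3) by (metis pathstart_in_path_image pathfinish_in_path_image)+
    then show "path_image c1 \<inter> path_image c2 = {p x, p y}"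
      "path_image c1 \<inter> path_image c = {p x, p y}" "path_image c2 \<inter> path_image c = {p x, p y}"
      using plane_graph_Int[OF pg sub(1,2) E12d] plane_graph_Int[OF pg sub(1,3) E1d]
        plane_graph_Int[OF pg sub(2,3) E2d]
      unfolding UU c1(4)[symmetric] c2(4)[symmetric] c(4)[symmetric] by auto
  qed
  \<comment> \<open>The theta curve lemma needs a chord that meets the inside; the point of
    \<open>w\<close> supplies it, as \<open>w\<close> is not on the cycle.\<close>
  have pw: "p w \<in> path_image c \<inter> inside J"
  proof
    show "p w \<in> path_image c"
      using plane_graph_vertex_on_edge[OF pg, of "{w, x}" w] w(1,3) EG VG
      unfolding c(4) by (auto simp: insert_commute)
    have "p w \<notin> J"
    proof
      assume "p w \<in> J"
      then obtain e where e: "e \<in> cycle_edges cs" "p w \<in> path_image (\<gamma> e)" unfolding J' by auto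
      then show False
        using plane_graph_vertex_on_edge[OF pg, of e w] w(1,2) cyc[OF e(1)] EG VG by auto
    qed
    moreover have "p w \<in> drawing G p \<gamma>"
      using w(1) by (auto simp: drawing_def VG)
    ultimately show "p w \<in> inside J" using DJ by blast
  qed
  \<comment> \<open>The two closed regions cut off by the chord; \<open>union_with_inside\<close>
    exhibits each as the complement of an open outside.\<close>
  define K1 where "K1 = path_image c1 \<union> path_image c \<union> inside (path_image c1 \<union> path_image c)"
  define K2 where "K2 = path_image c2 \<union> path_image c \<union> inside (path_image c2 \<union> path_image c)"
  have split: "inside (path_image c1 \<union> path_image c) \<inter> inside (path_image c2 \<union> path_image c) = {}
    \<and> inside (path_image c1 \<union> path_image c) \<union> inside (path_image c2 \<union> path_image c) \<union>
           (path_image c - {p x, p y}) = inside J"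
  proof (rule split_inside_simple_closed_curve[of c1 "p x" "p y" "reversepath c2" c])
    show "p x \<noteq> p y" using c1(1-3) by (metis arc_distinct_ends)
  qed (use c1 c2 c ends pw in \<open>auto simp: J_def arc_imp_simple_path arc_reversepath\<close>)
  \<comment> \<open>Points common to both regions lie on the chord, since the two insides are
    disjoint and lie in \<open>inside J\<close>, off both arcs of the cycle.\<close>
  have K: "K1 \<inter> K2 \<subseteq> path_image c" "J \<union> inside J \<subseteq> K1 \<union> K2"
  proof -
    have "inside J \<inter> path_image c1 = {}" "inside J \<inter> path_image c2 = {}"
      using inside_no_overlap[of J] unfolding J_def by blast+
    then show "K1 \<inter> K2 \<subseteq> path_image c" "J \<union> inside J \<subseteq> K1 \<union> K2"
      using split ends unfolding K1_def K2_def J_def by blast+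
  qed
  have "closed K1" "closed K2"
    using c1(1) c2(1) c(1) unfolding K1_def K2_def union_with_inside
    by (auto intro!: closed_Compl open_outside closed_Un closed_arc_image)
  have wG: "walk G ws"
    using ws(1) unfolding walk_def EG VG by (auto elim: successively_mono)
  have V: "connected V"
    unfolding V_def using wG by (rule plane_graph_walk_connected[OF pg])
  have wsG: "set ws \<subseteq> verts G" "path_edges ws \<subseteq> edges G"
    using wG path_edges_subset by (auto simp: walk_def)
  have Vc: "V \<inter> path_image c = {}"
  proof -
    have "p v \<notin> path_image c" if "v \<in> set ws" for v
    proof
      assume "p v \<in> path_image c"
      then obtain e where e: "e \<in> ?E" "p v \<in> path_image (\<gamma> e)" unfolding c(4) by blast
      then have "v \<in> e"
        using plane_graph_vertex_on_edge[OF pg, of e v] sub wsG that by blast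
      then show False using e(1) ws(2) that by auto
    qed
    moreover have dj: "\<Union>(path_edges ws) \<inter> \<Union>?E = {}"
      using Union_path_edges_subset[of ws] ws(2) by auto
    then have "path_edges ws \<inter> ?E = {}"
      by auto
    then have "(\<Union>e\<in>path_edges ws. path_image (\<gamma> e)) \<inter> path_image c = {}"
      using plane_graph_Int[OF pg wsG(2) sub(3)] dj unfolding c(4) by auto
    ultimately show ?thesis by (auto simp: V_def)
  qed
  have "V \<subseteq> drawing G p \<gamma>"
    using wsG by (auto simp: V_def drawing_def)
  then have "V \<subseteq> K1 \<union> K2" using DJ K by blast
  moreover have "K1 \<inter> K2 \<inter> V = {}" using K Vc by blast
  moreover have "p (hd ws) \<in> K1 \<inter> V"
  proof -
    obtain e where "e \<in> ?E1" "hd ws \<in> e" using U1 ws(3) by blast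
    then have "p (hd ws) \<in> path_image c1"
      using plane_graph_vertex_on_edge[OF pg, of e "hd ws"] sub wsG \<open>ws \<noteq> []\<close> unfolding c1(4)
      by (meson UN_I hd_in_set subsetD)
    then show ?thesis using \<open>ws \<noteq> []\<close> by (auto simp: K1_def V_def)
  qed
  moreover have "p (last ws) \<in> K2 \<inter> V"
  proof -
    obtain e where "e \<in> ?E2" "last ws \<in> e" using U2 ws(4) by (metis UnionE Un_commute insertCI set_append)
    then have "p (last ws) \<in> path_image c2"
      using plane_graph_vertex_on_edge[OF pg, of e "last ws"] sub wsG \<open>ws \<noteq> []\<close> unfolding c2(4)
      by (meson UN_I last_in_set subsetD)
    then show ?thesis using \<open>ws \<noteq> []\<close> by (auto simp: K2_def V_def)
  qed
  ultimately show False
    using V \<open>closed K1\<close> \<open>closed K2\<close> unfolding connected_closed by blast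
qed

section \<open>Colouring cycles from lists of size three\<close>

text \<open>No square of a word of length one or two: adjacent edges differ and no four consecutive
  edges alternate. All naturals are indices so that cyclic words can be treated as periodic
  sequences.\<close>

definition square_free2 :: "(nat \<Rightarrow> 'c) \<Rightarrow> bool" where
  "square_free2 f \<longleftrightarrow>
    (\<forall>i. f i \<noteq> f (Suc i) \<and> \<not> (f i = f (i + 2) \<and> f (i + 1) = f (i + 3)))"

lemma ex_avoiding:
  assumes "card F < card L" "finite F"
  shows "\<exists>x\<in>L. x \<notin> F"
  using assms by (meson card_mono leD subsetI)

lemma add_mod_if:
  fixes r k n :: nat
  assumes "r < n" "k \<le> n"
  shows "(r + k) mod n = (if r + k < n then r + k else r + k - n)"
  using assms by (simp add: le_mod_geq)

lemma square_free2_shift: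
  assumes "square_free2 f"
  shows "square_free2 (\<lambda>i. f (i + t))"
  unfolding square_free2_def
proof
  fix i
  have "f (i + t) \<noteq> f (Suc (i + t)) \<and> \<not> (f (i + t) = f (i + t + 2) \<and> f (i + t + 1) = f (i + t + 3))"
    using assms unfolding square_free2_def by blast
  then show "f (i + t) \<noteq> f (Suc i + t) \<and> \<not> (f (i + t) = f (i + 2 + t) \<and> f (i + 1 + t) = f (i + 3 + t))"
    by (simp add: ac_simps)
qed

lemma square_free2_mod:
  assumes "n \<ge> 3"
    and "\<And>r. r < n \<Longrightarrow> f r \<noteq> f ((r + 1) mod n)"
    and "\<And>r. r < n \<Longrightarrow> \<not> (f r = f ((r + 2) mod n) \<and> f ((r + 1) mod n) = f ((r + 3) mod n))"
  shows "square_free2 (\<lambda>i. f (i mod n))"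
proof -
  have "f (i mod n) \<noteq> f (Suc i mod n) \<and>
      \<not> (f (i mod n) = f ((i + 2) mod n) \<and> f ((i + 1) mod n) = f ((i + 3) mod n))" for i
    using assms(2,3)[of "i mod n"] assms(1)
    by (simp add: mod_add_left_eq mod_Suc_eq mod_Suc_Suc_eq)
  then show ?thesis by (simp add: square_free2_def)
qed

lemma cycle_colouring_distinct_lists:
  fixes L :: "nat \<Rightarrow> 'c set"
  assumes n: "n \<ge> 3" and L: "\<And>i. card (L i) = 3" and ne: "L 0 \<noteq> L 1"
  shows "\<exists>f. (\<forall>i<n. f i \<in> L i) \<and> square_free2 (\<lambda>i. f (i mod n))"
proof -
  have fin: "finite (L i)" for i
    using L[of i] by (metis card.infinite zero_neq_numeral)
  \<comment> \<open>Edge \<open>1\<close> gets \<open>\<alpha>\<close> and edge \<open>0\<close>, coloured last, never competes with it: only its two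
    predecessors \<open>n - 1\<close> and \<open>n - 2\<close> have to be avoided there.\<close>
  obtain \<alpha> where \<alpha>: "\<alpha> \<in> L 1" "\<alpha> \<notin> L 0"
    using ne L fin by (metis card_subset_eq subsetI)
  have avoid2: "\<exists>z\<in>L i. z \<noteq> x \<and> z \<noteq> y" for i x y
    using ex_avoiding[of "{x, y}" "L i"] L[of i] by (auto simp: card_insert_if)
  \<comment> \<open>The state is the pair of colours of edges \<open>i + 1\<close> and
    \<open>i + 2\<close>; each new colour avoids the two before it, which excludes alternation away
    from the seam.\<close>
  have "\<exists>s. \<forall>i. (case s i of (x, y) \<Rightarrow> x \<in> L (i + 1) \<and> y \<in> L (i + 2) \<and> x \<noteq> y \<and> (i = 0 \<longrightarrow> x = \<alpha>)) \<and>
      (case (s i, s (Suc i)) of ((x, y), (x', y')) \<Rightarrow> x' = y \<and> y' \<noteq> x)" (is "\<exists>s. ?P s")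
  proof (rule dependent_nat_choice)
    show "\<exists>p. case p of (x, y) \<Rightarrow> x \<in> L (0 + 1) \<and> y \<in> L (0 + 2) \<and> x \<noteq> y \<and> (0 = (0::nat) \<longrightarrow> x = \<alpha>)"
      using \<alpha>(1) avoid2[of 2 \<alpha> \<alpha>] by (auto simp: numeral_2_eq_2)
  next
    fix p i
    assume "case p of (x, y) \<Rightarrow> x \<in> L (i + 1) \<and> y \<in> L (i + 2) \<and> x \<noteq> y \<and> (i = 0 \<longrightarrow> x = \<alpha>)"
    moreover obtain x y where p: "p = (x, y)" by fastforce
    moreover obtain z where "z \<in> L (Suc i + 2)" "z \<noteq> x" "z \<noteq> y" using avoid2 by blast
    ultimately show "\<exists>q. (case q of (x, y) \<Rightarrow> x \<in> L (Suc i + 1) \<and> y \<in> L (Suc i + 2) \<and> x \<noteq> y \<and>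
        (Suc i = 0 \<longrightarrow> x = \<alpha>)) \<and> (case (p, q) of ((x, y), (x', y')) \<Rightarrow> x' = y \<and> y' \<noteq> x)"
      by (intro exI[of _ "(y, z)"]) auto
  qed
  then obtain s where s0: "?P s" ..
  note s = s0[rule_format, THEN conjunct1] s0[rule_format, THEN conjunct2]
  define h where "h i = fst (s i)" for i
  have h1: "h (Suc i) \<noteq> h i" for i
    using s(1)[of i] s(2)[of i] by (auto simp: h_def split: prod.splits)
  have h2: "h (Suc (Suc i)) \<noteq> h i" for i
    using s(2)[of i] s(2)[of "Suc i"] by (auto simp: h_def split: prod.splits)
  have hL: "h i \<in> L (Suc i)" and h0: "h 0 = \<alpha>" for i
    using s(1)[of i] s(1)[of 0] by (auto simp: h_def split: prod.splits)
  \<comment> \<open>\<open>x\<close> at edge \<open>n - 1\<close> differs from the colours of edges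
    \<open>n - 2\<close> and 1, and \<open>y\<close> at edge 0 from those of edges
    \<open>n - 1\<close> and \<open>n - 2\<close>. Every window across the seam then has an unequal
    pair at distance two.\<close>
  obtain x where x: "x \<in> L (n - 1)" "x \<noteq> h (n - 3)" "x \<noteq> \<alpha>" using avoid2 by blast
  obtain y where y: "y \<in> L 0" "y \<noteq> x" "y \<noteq> h (n - 3)" using avoid2 by blast
  have "y \<noteq> \<alpha>" using y \<alpha> by auto
  define f where "f i = (if i = 0 then y else if i = n - 1 then x else h (i - 1))" for i
  have "\<forall>i<n. f i \<in> L i"
  proof (intro allI impI)
    fix i assume "i < n"
    then show "f i \<in> L i"
      using hL[of "i - 1"] x y by (auto simp: f_def)
  qed
  moreover have "square_free2 (\<lambda>i. f (i mod n))"
  proof (rule square_free2_mod[OF n])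
    have f0: "f 0 = y" and f1: "f 1 = \<alpha>" and fn1: "f (n - 1) = x" and fn2: "f (n - 2) = h (n - 3)"
      using n h0 by (auto simp: f_def numeral_eq_Suc)
    fix r assume r: "r < n"
    have "r = 0 \<or> r = n - 1 \<or> r = n - 2 \<or> (1 \<le> r \<and> r + 2 < n)" using r by linarith
    then show "f r \<noteq> f ((r + 1) mod n)"
    proof (elim disjE)
      assume "1 \<le> r \<and> r + 2 < n"
      then show ?thesis
        using h1[of "r - 1"] by (auto simp: f_def)
    next
      assume "r = n - 2"
      then have "(r + 1) mod n = n - 1" using n by simp
      then show ?thesis using \<open>r = n - 2\<close> fn1 fn2 x by simp
    qed (use n f0 f1 fn1 \<open>y \<noteq> \<alpha>\<close> y in auto)
    have "(r = 0 \<and> n \<ge> 4) \<or> r = n - 1 \<or> r = n - 2 \<or> r = n - 3 \<or> (1 \<le> r \<and> r + 3 < n)"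
      using r by linarith
    then show "\<not> (f r = f ((r + 2) mod n) \<and> f ((r + 1) mod n) = f ((r + 3) mod n))"
    proof (elim disjE)
      assume "1 \<le> r \<and> r + 3 < n"
      then show ?thesis
        using h2[of "r - 1"] by (auto simp: f_def)
    next
      assume r: "r = 0 \<and> n \<ge> 4"
      have "f 1 \<noteq> f 3"
        using r f1 x h2[of 0] h0 by (auto simp: f_def numeral_eq_Suc)
      then show ?thesis using r by auto
    next
      assume "r = n - 1"
      then have "(r + 2) mod n = 1" using n add_mod_if[of r n 2] by simp
      then show ?thesis using \<open>r = n - 1\<close> f1 fn1 x by auto
    next
      assume "r = n - 2"
      then have "(r + 1) mod n = n - 1" "(r + 3) mod n = 1"
        using n add_mod_if[of r n 3] by auto
      then show ?thesis using f1 fn1 x by auto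
    next
      assume "r = n - 3"
      then have "(r + 1) mod n = n - 2" "(r + 3) mod n = 0" using n by auto
      then show ?thesis using f0 fn2 y by auto
    qed
  qed
  ultimately show ?thesis by blast
qed

text \<open>The colour word is glued from blocks of lengths four and three, so \<open>n\<close> must
  have the form \<open>4 * r + 3 * m\<close>; 5 is the only length from 3 on that does not.\<close>

lemma cycle_colouring_equal_lists:
  fixes X :: "'c set"
  assumes n: "n \<ge> 3" "n \<noteq> 5" and X: "card X = 3"
  shows "\<exists>f. (\<forall>i. f i \<in> X) \<and> square_free2 (\<lambda>i. f (i mod n))"
proof -
  obtain a b c where abc: "X = {a, b, c}" "a \<noteq> b" "b \<noteq> c" "a \<noteq> c"
    using X by (auto simp: card_3_iff)
  \<comment> \<open>\<open>r\<close> blocks of length four fix the residue of \<open>n\<close>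
    modulo 3; they fit unless \<open>n\<close> is 1, 2 or 5.\<close>
  define r where "r = n mod 3"
  define m where "m = n div 3 - r"
  have nr: "n = 4 * r + 3 * m"
  proof -
    have *: "n = 3 * (n div 3) + r" "r < 3" by (simp_all add: r_def)
    then have "n div 3 \<ge> 1" "n div 3 = 1 \<Longrightarrow> r \<noteq> 2" using n by linarith+
    then have "r \<le> n div 3" using *(2) by linarith
    then show ?thesis using * by (simp add: m_def)
  qed
  \<comment> \<open>\<open>r\<close> blocks \<open>abac\<close> followed by \<open>m\<close> blocks \<open>abc\<close>; every block starts with \<open>ab\<close> and ends
    with \<open>c\<close>\<close>
  define f where "f i = (if i < 4 * r then [a, b, a, c] ! (i mod 4) else [a, b, c] ! ((i - 4 * r) mod 3))" for i
  have "f i \<in> X" for i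
  proof -
    have "k mod 4 = 0 \<or> k mod 4 = 1 \<or> k mod 4 = 2 \<or> k mod 4 = 3"
      "k mod 3 = 0 \<or> k mod 3 = 1 \<or> k mod 3 = 2" for k :: nat
      by presburger+
    from this(1)[of i] this(2)[of "i - 4 * r"] show ?thesis unfolding f_def abc(1) by (elim disjE) simp_all
  qed
  moreover have "square_free2 (\<lambda>i. f (i mod n))"
  proof -
    define g where "g i = f (i mod n)" for i
    have A4: "g (4 * q) = a \<and> g (4 * q + 1) = b \<and> g (4 * q + 2) = a \<and> g (4 * q + 3) = c" if "q < r" for q
    proof -
      have f: "f (4 * q + k) = [a, b, a, c] ! k" "4 * q + k < n" if "k < 4" for k
      proof -
        have "4 * q + k < 4 * r" using \<open>q < r\<close> that by linarith
        moreover have "(4 * q + k) mod 4 = k" using that by simp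
        ultimately show "f (4 * q + k) = [a, b, a, c] ! k" "4 * q + k < n"
          unfolding f_def nr by auto
      qed
      show ?thesis
        unfolding g_def using f[of 0] f[of 1] f[of 2] f[of 3] by simp
    qed
    have A3: "g (4 * r + 3 * u) = a \<and> g (4 * r + 3 * u + 1) = b \<and> g (4 * r + 3 * u + 2) = c" if "u < m" for u
    proof -
      have f: "f (4 * r + 3 * u + k) = [a, b, c] ! k" "4 * r + 3 * u + k < n" if "k < 3" for k
      proof -
        have "(3 * u + k) mod 3 = k" using that by simp
        then show "f (4 * r + 3 * u + k) = [a, b, c] ! k"
          unfolding f_def by simp
        show "4 * r + 3 * u + k < n"
          unfolding nr using \<open>u < m\<close> that by linarith
      qed
      show ?thesis
        unfolding g_def using f[of 0] f[of 1] f[of 2] by simp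
    qed
    have wrap: "g n = a \<and> g (n + 1) = b"
    proof -
      have "g 0 = a \<and> g 1 = b"
      proof (cases "r = 0")
        case True
        then show ?thesis using A3[of 0] n nr by simp
      qed (use A4[of 0] in simp)
      then show ?thesis using n by (simp add: g_def mod_Suc)
    qed
    \<comment> \<open>Whatever block follows, cyclically, it starts with \<open>a\<close>,
      \<open>b\<close>.\<close>
    have next4: "g (4 * q + 4) = a \<and> g (4 * q + 5) = b" if "q < r" for q
    proof -
      consider "Suc q < r" | "Suc q = r" "m > 0" | "Suc q = r" "m = 0" using \<open>q < r\<close> by linarith
      then show ?thesis
      proof cases
        case 1
        then show ?thesis using A4[of "Suc q"] by (simp add: eval_nat_numeral)
      next
        case 2
        then show ?thesis using A3[of 0] by (auto simp: eval_nat_numeral)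
      next
        case 3
        then have "n = 4 * q + 4" "n + 1 = 4 * q + 5" using nr by simp_all
        then show ?thesis using wrap by metis
      qed
    qed
    have next3: "g (4 * r + 3 * u + 3) = a \<and> g (4 * r + 3 * u + 4) = b" if "u < m" for u
    proof (cases "Suc u = m")
      case True
      then have "n = 4 * r + 3 * u + 3" using nr by simp
      then show ?thesis using wrap by (simp add: eval_nat_numeral)
    next
      case False
      then show ?thesis using A3[of "Suc u"] that by (simp add: eval_nat_numeral)
    qed
    \<comment> \<open>Each window is settled by its own block and the two letters after it: from the
      last letter one reads \<open>c\<close>, \<open>a\<close>, \<open>b\<close>, and
      \<open>c\<close> differs from \<open>b\<close>.\<close>
    have "g j \<noteq> g (j + 1) \<and> \<not> (g j = g (j + 2) \<and> g (j + 1) = g (j + 3))" if "j < n" for j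
    proof (cases "j < 4 * r")
      case True
      define q where "q = j div 4"
      define h where "h k = g (4 * q + k)" for k
      have "q < r" using True by (simp add: q_def)
      then have h: "h 0 = a" "h 1 = b" "h 2 = a" "h 3 = c" "h 4 = a" "h 5 = b"
        using A4[of q] next4[of q] by (auto simp: h_def)
      define k where "k = j mod 4"
      have j: "g (j + i) = h (k + i)" for i by (simp add: h_def q_def k_def flip: add.assoc)
      have "k = 0 \<or> k = 1 \<or> k = 2 \<or> k = 3" unfolding k_def by presburger
      then have "h k \<noteq> h (k + 1) \<and> \<not> (h k = h (k + 2) \<and> h (k + 1) = h (k + 3))"
        by (elim disjE) (use h abc in \<open>simp_all flip: One_nat_def\<close>)
      then show ?thesis using j[of 0] j[of 1] j[of 2] j[of 3] by simp
    next
      case False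
      define u where "u = (j - 4 * r) div 3"
      define h where "h k = g (4 * r + 3 * u + k)" for k
      have "j - 4 * r < 3 * m" using that nr False by linarith
      then have "u < m" unfolding u_def by (simp add: less_mult_imp_div_less mult.commute)
      then have h: "h 0 = a" "h 1 = b" "h 2 = c" "h 3 = a" "h 4 = b"
        using A3[of u] next3[of u] by (auto simp: h_def)
      define k where "k = (j - 4 * r) mod 3"
      have "j = 4 * r + 3 * u + k"
        using False mult_div_mod_eq[of 3 "j - 4 * r"] unfolding u_def k_def by linarith
      then have j: "g (j + i) = h (k + i)" for i by (simp add: h_def flip: add.assoc)
      have "i mod 3 = 0 \<or> i mod 3 = 1 \<or> i mod 3 = 2" for i :: nat by presburger
      then have "k = 0 \<or> k = 1 \<or> k = 2" unfolding k_def .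
      then have "h k \<noteq> h (k + 1) \<and> \<not> (h k = h (k + 2) \<and> h (k + 1) = h (k + 3))"
        by (elim disjE) (use h abc in \<open>simp_all flip: One_nat_def\<close>)
      then show ?thesis using j[of 0] j[of 1] j[of 2] j[of 3] by simp
    qed
    then show ?thesis
      using n(1) unfolding g_def by (intro square_free2_mod) auto
  qed
  ultimately show ?thesis by blast
qed

text \<open>After shrinking the lists to size three, either two consecutive lists differ, and a
  rotation puts them at positions 0 and 1, or all lists agree.\<close>

lemma ex_cycle_colouring:
  fixes L :: "nat \<Rightarrow> 'c set"
  assumes n: "n \<ge> 3" "n \<noteq> 5" and L: "\<And>i. i < n \<Longrightarrow> card (L i) \<ge> 3"
  shows "\<exists>f. (\<forall>i<n. f i \<in> L i) \<and> square_free2 (\<lambda>i. f (i mod n))"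
proof -
  have "\<exists>X\<subseteq>L i. card X = 3" if "i < n" for i
    using L[OF that] by (metis obtain_subset_with_card_n)
  then obtain M where M: "\<And>i. i < n \<Longrightarrow> M i \<subseteq> L i \<and> card (M i) = 3" by metis
  define M' where "M' i = M (i mod n)" for i
  have n0: "n > 0" using n by simp
  have M': "card (M' i) = 3" for i using M[of "i mod n"] n0 by (simp add: M'_def)
  show ?thesis
  proof (cases "\<exists>s. M' s \<noteq> M' (Suc s)")
    case True
    then obtain s where s: "M' s \<noteq> M' (Suc s)" by blast
    have "\<exists>f. (\<forall>i<n. f i \<in> M' (i + s)) \<and> square_free2 (\<lambda>i. f (i mod n))"
      using M' s n by (intro cycle_colouring_distinct_lists) auto
    then obtain f where f: "\<And>i. i < n \<Longrightarrow> f i \<in> M' (i + s)" "square_free2 (\<lambda>i. f (i mod n))" by blast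
    \<comment> \<open>Since \<open>t + s\<close> is a multiple of \<open>n\<close>, shifting by
      \<open>t\<close> undoes the rotation by \<open>s\<close> without negative indices.\<close>
    define t where "t = n * s - s"
    have ts: "t + s = n * s" using n0 by (simp add: t_def)
    define g where "g i = f ((i + t) mod n)" for i
    have "g i \<in> L i" if "i < n" for i
    proof -
      have "f ((i + t) mod n) \<in> M' ((i + t) mod n + s)" using f n0 by simp
      moreover have "((i + t) mod n + s) mod n = i"
        using ts that by (simp add: mod_add_left_eq add.assoc)
      ultimately show ?thesis using M[OF that] by (auto simp: g_def M'_def)
    qed
    moreover have "g (i mod n) = f ((i + t) mod n)" for i
      by (simp add: g_def mod_add_left_eq)
    then have "square_free2 (\<lambda>i. g (i mod n))"
      using square_free2_shift[OF f(2), of t] by simp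
    ultimately show ?thesis by blast
  next
    case False
    have eq: "M' i = M' 0" for i
    proof (induction i)
      case (Suc i)
      then show ?case using False by metis
    qed simp
    have *: "M 0 \<subseteq> L i" if "i < n" for i
      using M[OF that] eq[of i] that n0 by (simp add: M'_def)
    have "card (M 0) = 3" using M n0 by blast
    from cycle_colouring_equal_lists[OF n this] show ?thesis using * by blast
  qed
qed

section \<open>Colouring the tree\<close>

definition nbrs :: "'a graph \<Rightarrow> 'a \<Rightarrow> 'a set" where
  "nbrs G v = {u. {v, u} \<in> edges G}"

text \<open>Position \<open>i\<close> has to avoid its own set \<open>F\<close> and at most
  \<open>i\<close> colours given before, so the order of the list decides how much room each element
  has.\<close>

lemma greedy_choice:
  fixes L F :: "'a \<Rightarrow> 'c set"
  assumes "distinct us"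
    and "\<And>i. i < length us \<Longrightarrow> finite (F (us ! i)) \<and> card (F (us ! i)) + i < card (L (us ! i))"
  shows "\<exists>f. inj_on f (set us) \<and> (\<forall>u\<in>set us. f u \<in> L u \<and> f u \<notin> F u)"
  using assms
proof (induction us rule: rev_induct)
  case (snoc u us)
  have "finite (F (us ! i)) \<and> card (F (us ! i)) + i < card (L (us ! i))" if "i < length us" for i
    using snoc.prems(2)[of i] that by (simp add: nth_append)
  then obtain f where f: "inj_on f (set us)" "\<forall>v\<in>set us. f v \<in> L v \<and> f v \<notin> F v"
    using snoc by auto
  have "card (F u \<union> f ` set us) < card (L u)" and fin: "finite (F u)"
    using snoc.prems(2)[of "length us"] card_Un_le[of "F u" "f ` set us"]
      card_image_le[of "set us" f] card_length[of us] by auto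
  then obtain x where x: "x \<in> L u" "x \<notin> F u \<union> f ` set us"
    by (meson card_mono fin finite_UnI finite_imageI finite_set leD subsetI)
  have "u \<notin> set us" using snoc.prems(1) by simp
  then show ?case
    using f x by (intro exI[of _ "f(u := x)"]) (auto simp: inj_on_def)
qed simp

text \<open>The circulant tournament in which every vertex points to the next half of the cyclic order
  (opposite vertices point to each other).\<close>

lemma circulant_tournament:
  assumes "distinct ns" "ns \<noteq> []"
  shows "\<exists>A. (\<forall>y\<in>set ns. \<forall>z\<in>set ns. y \<noteq> z \<longrightarrow> A y z \<or> A z y) \<and>
    (\<forall>y. card {z \<in> set ns. A y z} \<le> length ns div 2) \<and>
    (\<forall>z. A (hd ns) z \<longrightarrow> z \<in> set (take (length ns div 2) (tl ns)))"
proof -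
  define d where "d = length ns"
  have d: "d > 0" using assms by (simp add: d_def)
  define A where "A y z \<longleftrightarrow> (\<exists>i j. i < d \<and> j < d \<and> ns ! i = y \<and> ns ! j = z \<and>
      (j + d - i) mod d \<in> {1..d div 2})" for y z
  have tot: "(j + d - i) mod d \<in> {1..d div 2} \<or> (i + d - j) mod d \<in> {1..d div 2}"
    if "i < d" "j < d" "i < j" for i j
  proof -
    have "(j + d - i) mod d = j - i"
      using that by (metis Nat.add_diff_assoc2 less_imp_diff_less less_imp_le mod_add_self2 mod_less)
    moreover have "(i + d - j) mod d = d - (j - i)" using that by simp
    ultimately show ?thesis using that by auto
  qed
  have "A y z \<or> A z y" if yz: "y \<in> set ns" "z \<in> set ns" "y \<noteq> z" for y z
  proof -
    obtain i j where "i < d" "j < d" "ns ! i = y" "ns ! j = z"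
      using yz by (auto simp: in_set_conv_nth d_def)
    moreover have "i < j \<or> j < i" using calculation yz(3) by (metis linorder_neqE_nat)
    ultimately show ?thesis
      unfolding A_def using tot by blast
  qed
  moreover have "card {z \<in> set ns. A y z} \<le> d div 2" for y
  proof (cases "y \<in> set ns")
    case True
    then obtain i where i: "i < d" "ns ! i = y" by (auto simp: in_set_conv_nth d_def)
    \<comment> \<open>Out-neighbours of position \<open>i\<close> are among the next
      \<open>d div 2\<close> positions modulo \<open>d\<close>.\<close>
    have "{z \<in> set ns. A y z} \<subseteq> (\<lambda>k. ns ! ((i + k) mod d)) ` {1..d div 2}"
    proof
      fix z assume "z \<in> {z \<in> set ns. A y z}"
      then obtain i' j where ij: "i' < d" "j < d" "ns ! i' = y" "ns ! j = z"
        "(j + d - i') mod d \<in> {1..d div 2}"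
        by (auto simp: A_def)
      then have "i' = i" using i assms(1) nth_eq_iff_index_eq unfolding d_def by metis
      moreover have "(i + (j + d - i) mod d) mod d = j"
        using i(1) ij(2) by (simp add: mod_add_right_eq)
      ultimately show "z \<in> (\<lambda>k. ns ! ((i + k) mod d)) ` {1..d div 2}"
        using ij by (intro image_eqI[of _ _ "(j + d - i) mod d"]) simp_all
    qed
    then have "card {z \<in> set ns. A y z} \<le> card {1..d div 2}"
      by (rule surj_card_le[rotated]) simp
    then show ?thesis by simp
  next
    case False
    then have "{z \<in> set ns. A y z} = {}" by (auto simp: A_def d_def)
    then show ?thesis by (metis card.empty zero_le)
  qed
  \<comment> \<open>The first vertex has index 0, so it points only to the entries right after it.
    The order of the list thus controls which edges it constrains.\<close>
  moreover have "z \<in> set (take (d div 2) (tl ns))" if "A (hd ns) z" for z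
  proof -
    obtain i j where ij: "i < d" "j < d" "ns ! i = hd ns" "ns ! j = z"
        "(j + d - i) mod d \<in> {1..d div 2}"
      using \<open>A (hd ns) z\<close> by (auto simp: A_def)
    then have "i = 0" using assms d by (simp add: d_def nth_eq_iff_index_eq hd_conv_nth)
    then have j: "1 \<le> j" "j \<le> d div 2" using ij by auto
    have "z = tl ns ! (j - 1)" using ij(4) j assms(2) by (cases ns) auto
    moreover have "j - 1 < length (take (d div 2) (tl ns))" using j ij(2) by (auto simp: d_def)
    ultimately show ?thesis by (metis nth_mem nth_take length_take min_less_iff_conj)
  qed
  ultimately show ?thesis unfolding d_def by blast
qed

text \<open>At most two exceptional elements can be placed right after \<open>h\<close> ordinary
  ones. In the greedy colouring these are the cheapest positions behind the first \<open>h\<close>,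
  where larger forbidden sets apply.\<close>

lemma arrange_exceptional:
  assumes "finite U" "card (U \<inter> K) \<le> 2"
  shows "\<exists>us. distinct us \<and> set us = U \<and> (h + 2 \<le> length us \<longrightarrow>
    (\<forall>i<length us. us ! i \<in> K \<longrightarrow> h \<le> i \<and> i \<le> h + 1))"
proof (cases "h + 2 \<le> card U")
  case True
  have "card (U - K) = card U - card (U \<inter> K)"
    using assms(1) by (simp add: card_Diff_subset_Int)
  then have "h \<le> card (U - K)" using True assms(2) by linarith
  then obtain X where X: "X \<subseteq> U - K" "card X = h" "finite X"
    using obtain_subset_with_card_n assms(1) by (metis finite_Diff finite_subset)
  obtain xs where xs: "set xs = X" "distinct xs"
    using X(3) finite_distinct_list[of X] by auto
  obtain ys where ys: "set ys = U \<inter> K" "distinct ys"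
    using assms(1) finite_distinct_list[of "U \<inter> K"] by auto
  obtain zs where zs: "set zs = U - K - X" "distinct zs"
    using assms(1) finite_distinct_list[of "U - K - X"] by auto
  have len: "length xs = h" "length ys \<le> 2"
    using xs ys X assms(2) distinct_card by metis+
  have "h \<le> i \<and> i \<le> h + 1" if "i < length (xs @ ys @ zs)" "(xs @ ys @ zs) ! i \<in> K" for i
  proof -
    have "\<not> i < h" using that len xs X by (auto simp: nth_append)
    moreover have "\<not> h + length ys \<le> i"
    proof
      assume "h + length ys \<le> i"
      then have "(xs @ ys @ zs) ! i = zs ! (i - h - length ys)" "i - h - length ys < length zs"
        using len that by (auto simp: nth_append)
      then show False using that zs by (metis DiffD1 DiffD2 nth_mem)
    qed
    ultimately show ?thesis using len by linarith
  qed
  moreover have "distinct (xs @ ys @ zs)" "set (xs @ ys @ zs) = U"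
    using xs ys zs X by auto
  ultimately show ?thesis by blast
next
  case False
  obtain us where "set us = U" "distinct us"
    using assms(1) finite_distinct_list[of U] by auto
  then show ?thesis using False distinct_card by metis
qed

section \<open>Neighbourhoods and connected vertex sets\<close>

lemma nbrs_sym: "u \<in> nbrs G v \<longleftrightarrow> v \<in> nbrs G u"
  by (simp add: nbrs_def insert_commute)

lemma nbrs_simple:
  assumes "simple_graph G" "u \<in> nbrs G v"
  shows "u \<in> verts G" "v \<in> verts G" "u \<noteq> v"
  using assms by (auto simp: simple_graph_def nbrs_def)

lemma finite_nbrs: "simple_graph G \<Longrightarrow> finite (nbrs G v)"
  using nbrs_simple(1) by (metis finite_subset simple_graph_def subsetI)

lemma degree_eq_card_nbrs:
  assumes "simple_graph G"
  shows "degree G v = card (nbrs G v)"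
proof -
  have "{e \<in> edges G. v \<in> e} = (\<lambda>u. {v, u}) ` nbrs G v"
  proof
    show "{e \<in> edges G. v \<in> e} \<subseteq> (\<lambda>u. {v, u}) ` nbrs G v"
    proof
      fix e assume e: "e \<in> {e \<in> edges G. v \<in> e}"
      then have "card e = 2" using assms by (auto simp: simple_graph_def)
      then obtain u where "e = {v, u}" using e by (auto simp: card_2_iff doubleton_eq_iff)
      then show "e \<in> (\<lambda>u. {v, u}) ` nbrs G v" using e by (auto simp: nbrs_def)
    qed
  qed (auto simp: nbrs_def)
  moreover have "inj_on (\<lambda>u. {v, u}) (nbrs G v)"
    by (auto simp: inj_on_def doubleton_eq_iff)
  ultimately show ?thesis by (simp add: degree_def card_image)
qed

text \<open>Paths instead of walks, so that an outside vertex adjacent to both ends of such a path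
  closes it to a cycle.\<close>

definition path_connected_set :: "'a graph \<Rightarrow> 'a set \<Rightarrow> bool" where
  "path_connected_set G S \<longleftrightarrow> S \<subseteq> verts G \<and> S \<noteq> {} \<and>
    (\<forall>a\<in>S. \<forall>b\<in>S. \<exists>vs. path_in G vs \<and> set vs \<subseteq> S \<and> hd vs = a \<and> last vs = b)"

lemma path_in_Cons:
  assumes "path_in G vs" "w \<in> nbrs G (hd vs)" "w \<in> verts G" "w \<notin> set vs"
  shows "path_in G (w # vs)"
  using assms by (cases vs) (auto simp: path_in_def walk_def nbrs_def insert_commute)

lemma path_in_rev: "path_in G vs \<Longrightarrow> path_in G (rev vs)"
  by (auto simp: path_in_def walk_def successively_rev insert_commute)

text \<open>Two such neighbours, joined by a path in \<open>S\<close> and by \<open>w\<close>, would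
  give a cycle.\<close>

lemma tree_unique_nbr:
  assumes T: "tree T" and S: "path_connected_set T S" and w: "w \<in> verts T" "w \<notin> S"
    and v: "v \<in> S" "v \<in> nbrs T w" and v': "v' \<in> S" "v' \<in> nbrs T w"
  shows "v = v'"
proof (rule ccontr)
  assume ne: "v \<noteq> v'"
  obtain vs where vs: "path_in T vs" "set vs \<subseteq> S" "hd vs = v" "last vs = v'"
    using S v(1) v'(1) unfolding path_connected_set_def by blast
  have "length vs \<ge> 2"
    using vs ne by (cases vs; cases "tl vs") (auto simp: path_in_def walk_def)
  moreover have "path_in T (w # vs)"
    using vs w v by (intro path_in_Cons) (auto simp: nbrs_sym[of w])
  ultimately have "cycle_in T (w # vs)"
    using vs v' by (auto simp: cycle_in_def nbrs_def insert_commute)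
  then show False using T by (auto simp: tree_def)
qed

lemma path_connected_set_insert:
  assumes S: "path_connected_set G S" and w: "w \<in> verts G" "w \<notin> S" and v: "v \<in> S" "v \<in> nbrs G w"
  shows "path_connected_set G (insert w S)"
proof -
  have wpath: "\<exists>vs. path_in G vs \<and> set vs \<subseteq> insert w S \<and> hd vs = w \<and> last vs = b" if b: "b \<in> S" for b
  proof -
    obtain vs where vs: "path_in G vs" "set vs \<subseteq> S" "hd vs = v" "last vs = b"
      using S v b unfolding path_connected_set_def by blast
    then have "path_in G (w # vs)"
      using w v by (intro path_in_Cons) (auto simp: nbrs_sym[of w])
    then show ?thesis
      using vs by (intro exI[of _ "w # vs"]) (auto simp: path_in_def walk_def)
  qed
  have pathw: "\<exists>vs. path_in G vs \<and> set vs \<subseteq> insert w S \<and> hd vs = b \<and> last vs = w" if b: "b \<in> S" for b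
  proof -
    obtain vs where "path_in G vs" "set vs \<subseteq> insert w S" "hd vs = w" "last vs = b"
      using wpath[OF b] by blast
    then show ?thesis
      using path_in_rev[of G vs]
      by (intro exI[of _ "rev vs"]) (auto simp: hd_rev last_rev)
  qed
  have "path_in G [w]" using w by (simp add: path_in_def walk_def)
  then have "\<exists>vs. path_in G vs \<and> set vs \<subseteq> insert w S \<and> hd vs = w \<and> last vs = w"
    by (intro exI[of _ "[w]"]) auto
  then show ?thesis
    using S w wpath pathw unfolding path_connected_set_def
    by (auto) (metis subset_insertI2)+
qed

text \<open>A walk from \<open>S\<close> to a vertex outside has a step that leaves
  \<open>S\<close>; its target serves as \<open>w\<close>.\<close>

lemma connected_exit:
  assumes "connected_graph G" "S \<subseteq> verts G" "S \<noteq> {}" "S \<noteq> verts G"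
  shows "\<exists>w\<in>verts G - S. nbrs G w \<inter> S \<noteq> {}"
proof -
  obtain a b where ab: "a \<in> S" "b \<in> verts G - S" using assms by blast
  then obtain vs where vs: "walk G vs" "hd vs = a" "last vs = b"
    using assms unfolding connected_graph_def by blast
  have "\<exists>w\<in>verts G - S. nbrs G w \<inter> S \<noteq> {}" if "walk G vs" "hd vs \<in> S" "last vs \<notin> S" for vs
    using that
  proof (induction vs)
    case (Cons x vs)
    show ?case
    proof (cases vs)
      case (Cons y us)
      then have *: "walk G vs" "{x, y} \<in> edges G" "y \<in> verts G" "last vs \<notin> S" "hd vs = y" "x \<in> S"
        using Cons.prems by (auto simp: walk_def)
      show ?thesis
      proof (cases "y \<in> S")
        case False
        then show ?thesis using * by (intro bexI[of _ y]) (auto simp: nbrs_def insert_commute)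
      qed (use Cons.IH * in auto)
    qed (use Cons.prems in simp)
  qed (simp add: walk_def)
  then show ?thesis using vs ab by blast
qed

text \<open>The data for colouring the tree alone. \<open>Q\<close> stands for adjacency on the
  adjoint cycle, and \<open>Q_planar\<close> carries all that is used of planarity here. The
  condition \<open>k_edge\<close> comes from the first term of the bound and \<open>kD\<close> from
  the second.\<close>

locale tree_colouring =
  fixes T :: "'a graph" and L :: "'a set \<Rightarrow> nat set" and k D :: nat and Q :: "'a \<Rightarrow> 'a \<Rightarrow> bool"
  assumes T: "tree T"
    and L: "e \<in> edges T \<Longrightarrow> k \<le> card (L e)"
    and D: "v \<in> verts T \<Longrightarrow> degree T v \<le> D"
    and kD: "2 * (D div 2) + 7 \<le> k"
    and k_edge: "{v, w} \<in> edges T \<Longrightarrow> degree T w + degree T v div 2 \<le> k"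
    and Q_sym: "Q u u' \<Longrightarrow> Q u' u"
    and Q_irrefl: "\<not> Q u u"
    and Q_leaf: "Q u u' \<Longrightarrow> degree T u = 1"
    and Q_card: "finite {u'. Q u u'}" "card {u'. Q u u'} \<le> 2"
    and Q_planar: "path_connected_set T S \<Longrightarrow> (\<forall>u\<in>S. degree T u = 1 \<longrightarrow> nbrs T u \<subseteq> S) \<Longrightarrow>
      w \<in> verts T - S \<Longrightarrow> card {u \<in> nbrs T w. \<exists>u'. Q u u' \<and> nbrs T u' \<inter> S \<noteq> {}} \<le> 2"
begin

text \<open>The relation \<open>A v y z\<close> forbids the colour of \<open>vz\<close> on all edges at \<open>y\<close>; as \<open>A v\<close> is total,
  no path centred at \<open>v\<close> is bichromatic. The bound on its out-degrees keeps enough colours for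
  the edges at \<open>y\<close>.\<close>

definition partial :: "'a set \<Rightarrow> ('a set \<Rightarrow> nat) \<Rightarrow> ('a \<Rightarrow> 'a \<Rightarrow> 'a \<Rightarrow> bool) \<Rightarrow> bool" where
  "partial S c A \<longleftrightarrow> path_connected_set T S \<and>
    (\<forall>u\<in>S. degree T u = 1 \<longrightarrow> nbrs T u \<subseteq> S) \<and>
    (\<forall>e\<in>edges T. e \<inter> S \<noteq> {} \<longrightarrow> c e \<in> L e) \<and>
    (\<forall>v\<in>S. inj_on (\<lambda>z. c {v, z}) (nbrs T v)) \<and>
    (\<forall>v\<in>S. \<forall>y\<in>nbrs T v. \<forall>z\<in>nbrs T v. y \<noteq> z \<longrightarrow> A v y z \<or> A v z y) \<and>
    (\<forall>v\<in>S. \<forall>y\<in>nbrs T v. \<forall>z\<in>nbrs T v. \<forall>x\<in>nbrs T y.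
       A v y z \<longrightarrow> y \<noteq> z \<longrightarrow> x \<noteq> v \<longrightarrow> y \<in> S \<or> x \<in> S \<longrightarrow> c {y, x} \<noteq> c {v, z}) \<and>
    (\<forall>v\<in>S. \<forall>y\<in>nbrs T v. card {z \<in> nbrs T v. A v y z} \<le> degree T v div 2) \<and>
    (\<forall>u u' x y. Q u u' \<longrightarrow> x \<in> S \<inter> nbrs T u \<longrightarrow> y \<in> S \<inter> nbrs T u' \<longrightarrow> c {x, u} \<noteq> c {y, u'})"

section \<open>Building the colouring of the tree from a root\<close>

lemma simple: "simple_graph T" and connected: "connected_graph T"
  using T by (auto simp: tree_def)

text \<open>A root of degree at least two makes the clause on leaves vacuous. Its edges get distinct
  colours, which is possible as \<open>D < k\<close>.\<close>

lemma partial_start: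
  assumes r: "r \<in> verts T" "degree T r \<ge> 2"
  shows "\<exists>c A. partial {r} c A"
proof -
  obtain us where us: "set us = nbrs T r" "distinct us"
    using finite_nbrs[OF simple] finite_distinct_list by metis
  have len: "length us = degree T r"
    using us distinct_card degree_eq_card_nbrs[OF simple] by metis
  then have "us \<noteq> []" using r by auto
  obtain A where A: "\<forall>y\<in>set us. \<forall>z\<in>set us. y \<noteq> z \<longrightarrow> A y z \<or> A z y"
      "\<forall>y. card {z \<in> set us. A y z} \<le> length us div 2"
    using circulant_tournament[OF us(2) \<open>us \<noteq> []\<close>] by auto
  have "card {} + i < card (L {r, us ! i})" if "i < length us" for i
  proof -
    have "us ! i \<in> nbrs T r" using nth_mem[OF that] us(1) by simp
    then have "k \<le> card (L {r, us ! i})" by (auto intro!: L simp: nbrs_def)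
    then show ?thesis using that len D[OF r(1)] kD by simp
  qed
  then obtain f where f: "inj_on f (set us)" "\<forall>u\<in>set us. f u \<in> L {r, u}"
    using greedy_choice[OF us(2), of "\<lambda>_. {}" "\<lambda>u. L {r, u}"] by auto
  define c where "c e = f (THE u. e = {r, u})" for e
  have c: "c {r, u} = f u" "c {u, r} = f u" for u
    unfolding c_def by (auto simp: doubleton_eq_iff intro!: arg_cong[of _ _ f] the_equality)
  have cL: "c e \<in> L e" if e: "e \<in> edges T" "r \<in> e" for e
  proof -
    have "card e = 2" using that simple by (auto simp: simple_graph_def)
    then obtain u where "e = {r, u}" using e(2) by (auto simp: card_2_iff doubleton_eq_iff)
    then show ?thesis using c f us that by (auto simp: nbrs_def)
  qed
  have "path_connected_set T {r}"
    using r unfolding path_connected_set_def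
    by (auto intro!: exI[of _ "[r]"] simp: path_in_def walk_def)
  have pair: "c {x, u} \<noteq> c {y, u'}" if "Q u u'" "x \<in> {r} \<inter> nbrs T u" "y \<in> {r} \<inter> nbrs T u'" for u u' x y
  proof -
    have "u \<noteq> u'" using that(1) Q_irrefl by blast
    then show ?thesis using that(2,3) f(1) us(1) by (auto simp: c nbrs_sym[of r] inj_on_def)
  qed
  have inj: "inj_on (\<lambda>z. c {r, z}) (nbrs T r)"
    using f(1) by (simp add: c us(1))
  have "partial {r} c (\<lambda>_. A)"
    unfolding partial_def
  proof (intro conjI ballI allI impI)
    show "path_connected_set T {r}" by fact
  next
    fix u assume "u \<in> {r}" "degree T u = 1"
    then show "nbrs T u \<subseteq> {r}" using r(2) by simp
  next
    fix e assume "e \<in> edges T" "e \<inter> {r} \<noteq> {}"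
    then show "c e \<in> L e" using cL by blast
  next
    fix v assume "v \<in> {r}"
    then show "inj_on (\<lambda>z. c {v, z}) (nbrs T v)" using inj by simp
  next
    fix v y z assume "v \<in> {r}" "y \<in> nbrs T v" "z \<in> nbrs T v" "y \<noteq> z"
    then show "A y z \<or> A z y" using A(1) us(1) by simp
  next
    fix v y z x
    assume "v \<in> {r}" "y \<in> nbrs T v" "x \<noteq> v" "y \<in> {r} \<or> x \<in> {r}"
    \<comment> \<open>Vacuous: \<open>y\<close> and \<open>x\<close> both differ from
      \<open>r\<close>.\<close>
    then show "c {y, x} \<noteq> c {v, z}" using nbrs_simple(3)[OF simple] by blast
  next
    fix v y assume "v \<in> {r}" "y \<in> nbrs T v"
    then show "card {z \<in> nbrs T v. A y z} \<le> degree T v div 2"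
      using A(2) by (simp add: us(1) len)
  next
    fix u u' x y
    assume "Q u u'" "x \<in> {r} \<inter> nbrs T u" "y \<in> {r} \<inter> nbrs T u'"
    then show "c {x, u} \<noteq> c {y, u'}" by (rule pair)
  qed
  then show ?thesis by blast
qed

text \<open>A new vertex \<open>w\<close> has exactly one neighbour \<open>v\<close> in
  \<open>S\<close>. The other edges at \<open>w\<close> are coloured greedily: the first
  \<open>d div 2\<close> avoid every colour at \<open>v\<close>, so that \<open>v\<close> may point
  to them in the new tournament at \<open>w\<close>, and the rest avoid the colour of
  \<open>vw\<close> and what the tournament at \<open>v\<close> forbids at \<open>w\<close>. All
  avoid the colours of conflicting leaf edges.\<close>

lemma partial_step:
  assumes p: "partial S c A" and "S \<noteq> verts T"
  shows "\<exists>w c' A'. w \<in> verts T - S \<and> partial (insert w S) c' A'"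
proof -
  note pS = p[unfolded partial_def]
  have S: "path_connected_set T S" and leaf: "\<And>u. u \<in> S \<Longrightarrow> degree T u = 1 \<Longrightarrow> nbrs T u \<subseteq> S"
    using pS by auto
  have lists: "\<And>e. e \<in> edges T \<Longrightarrow> e \<inter> S \<noteq> {} \<Longrightarrow> c e \<in> L e"
    and inj: "\<And>v. v \<in> S \<Longrightarrow> inj_on (\<lambda>z. c {v, z}) (nbrs T v)"
    and total: "\<And>v y z. v \<in> S \<Longrightarrow> y \<in> nbrs T v \<Longrightarrow> z \<in> nbrs T v \<Longrightarrow> y \<noteq> z \<Longrightarrow> A v y z \<or> A v z y"
    using pS by auto
  have forbid: "\<And>v y z x. v \<in> S \<Longrightarrow> y \<in> nbrs T v \<Longrightarrow> z \<in> nbrs T v \<Longrightarrow> x \<in> nbrs T y \<Longrightarrow> A v y z \<Longrightarrow>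
      y \<noteq> z \<Longrightarrow> x \<noteq> v \<Longrightarrow> y \<in> S \<or> x \<in> S \<Longrightarrow> c {y, x} \<noteq> c {v, z}"
    using pS by blast
  have out: "\<And>v y. v \<in> S \<Longrightarrow> y \<in> nbrs T v \<Longrightarrow> card {z \<in> nbrs T v. A v y z} \<le> degree T v div 2"
    using pS by blast
  have leafpair: "\<And>u u' x y. Q u u' \<Longrightarrow> x \<in> S \<inter> nbrs T u \<Longrightarrow> y \<in> S \<inter> nbrs T u' \<Longrightarrow> c {x, u} \<noteq> c {y, u'}"
    using pS by blast
  have "S \<subseteq> verts T" "S \<noteq> {}" using S by (auto simp: path_connected_set_def)
  then obtain w v where w: "w \<in> verts T" "w \<notin> S" and v: "v \<in> S" "v \<in> nbrs T w"
    using connected_exit[OF connected] assms(2) by blast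
  have wv: "w \<in> nbrs T v" using v by (simp add: nbrs_sym)
  have S': "path_connected_set T (insert w S)"
    using path_connected_set_insert S w v by metis
  have uniq: "v' = v" if "v' \<in> S" "v' \<in> nbrs T w" for v'
    using tree_unique_nbr[OF T S w] that v by blast
  define U where "U = nbrs T w - {v}"
  have U: "u \<notin> S" "u \<noteq> w" "u \<in> nbrs T w" "w \<in> nbrs T u" "{w, u} \<in> edges T" if "u \<in> U" for u
    using that uniq nbrs_simple(3)[OF simple] by (auto simp: U_def nbrs_sym) (auto simp: nbrs_def insert_commute)
  \<comment> \<open>By uniqueness for \<open>insert w S\<close>, the far ends of the new edges have
    no neighbour in \<open>S\<close>.\<close>
  have far: False if "u \<notin> S" "u \<noteq> w" "u \<in> nbrs T w" "x \<in> nbrs T u" "x \<in> S" for u x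
    using tree_unique_nbr[OF T S', of u x w] that nbrs_simple[OF simple] w by (metis insertE insertI1 insertI2 nbrs_sym)
  \<comment> \<open>\<open>K\<close> collects the neighbours of \<open>w\<close> whose edge to
    \<open>w\<close> conflicts with an already coloured tree edge at an adjacent leaf of the
    cycle.\<close>
  define K where "K = {u \<in> nbrs T w. \<exists>u'. Q u u' \<and> nbrs T u' \<inter> S \<noteq> {}}"
  have "card K \<le> 2" unfolding K_def using Q_planar[OF S] leaf w by blast
  have "finite U" by (simp add: U_def finite_nbrs[OF simple])
  moreover have "card (U \<inter> K) \<le> 2"
    using \<open>card K \<le> 2\<close> card_mono[of K "U \<inter> K"] finite_nbrs[OF simple, of w] by (auto simp: K_def)
  ultimately obtain us where us: "distinct us" "set us = U"
    and usK: "degree T w div 2 + 2 \<le> length us \<Longrightarrow> i < length us \<Longrightarrow> us ! i \<in> K \<Longrightarrow>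
      degree T w div 2 \<le> i \<and> i \<le> degree T w div 2 + 1" for i
    using arrange_exceptional[of U K "degree T w div 2"] by blast
  define d where "d = degree T w"
  have Uw: "nbrs T w = insert v U" "v \<notin> U" using v by (auto simp: U_def)
  have len: "d = Suc (length us)"
    using degree_eq_card_nbrs[OF simple, of w] Uw us distinct_card[OF us(1)] \<open>finite U\<close>
    by (simp add: d_def)
  have vus: "set (v # us) = nbrs T w" "length (v # us) = d" "distinct (v # us)" "v # us \<noteq> []"
    using us Uw len by auto
  \<comment> \<open>\<open>v\<close> heads the list, so it points only to the first
    \<open>d div 2\<close> members of \<open>us\<close>.\<close>
  obtain Aw where Aw: "\<forall>y\<in>nbrs T w. \<forall>z\<in>nbrs T w. y \<noteq> z \<longrightarrow> Aw y z \<or> Aw z y"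
      "\<forall>y. card {z \<in> nbrs T w. Aw y z} \<le> d div 2"
      "\<forall>z. Aw v z \<longrightarrow> z \<in> set (take (d div 2) us)"
    using circulant_tournament[OF vus(3,4)] unfolding vus list.sel by (elim exE conjE) (rule that)
  \<comment> \<open>Colours already used on the tree edges of partners of \<open>u\<close>;
    \<open>THE\<close> picks the single neighbour of the leaf \<open>u'\<close>.\<close>
  define conf where "conf u = (\<lambda>u'. c {THE y. y \<in> nbrs T u', u'}) ` {u'. Q u u' \<and> nbrs T u' \<inter> S \<noteq> {}}" for u
  have conf: "c {y, u'} \<in> conf u" if "Q u u'" "y \<in> S" "y \<in> nbrs T u'" for u u' y
  proof -
    have "card (nbrs T u') = 1"
      using Q_leaf Q_sym that(1) degree_eq_card_nbrs[OF simple] by metis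
    then have "nbrs T u' = {y}" using that(3) by (auto simp: card_1_singleton_iff)
    then have "(THE y. y \<in> nbrs T u') = y" "nbrs T u' \<inter> S \<noteq> {}" using that by auto
    then show ?thesis using that(1) unfolding conf_def by (metis (mono_tags, lifting) image_eqI mem_Collect_eq)
  qed
  have conf_fin: "finite {u'. Q u u' \<and> nbrs T u' \<inter> S \<noteq> {}}" for u
    using Q_card(1)[of u] by (rule rev_finite_subset) auto
  have conf2: "card (conf u) \<le> 2" "finite (conf u)" for u
  proof -
    show "finite (conf u)" using conf_fin by (simp add: conf_def)
    have "card (conf u) \<le> card {u'. Q u u' \<and> nbrs T u' \<inter> S \<noteq> {}}"
      unfolding conf_def using conf_fin by (rule card_image_le)
    also have "\<dots> \<le> card {u'. Q u u'}" using Q_card(1)[of u] by (rule card_mono) auto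
    finally show "card (conf u) \<le> 2" using Q_card(2)[of u] by simp
  qed
  have conf0: "conf u = {}" if "u \<in> U" "u \<notin> K" for u
    using that by (auto simp: conf_def K_def U_def)
  \<comment> \<open>\<open>Cv\<close> holds all colours at \<open>v\<close>; \<open>Bv\<close> holds
    the colour of \<open>vw\<close> and those that the tournament at \<open>v\<close> forbids on the
    edges at \<open>w\<close>.\<close>
  define Cv where "Cv = (\<lambda>z. c {v, z}) ` nbrs T v"
  define Bv where "Bv = insert (c {v, w}) ((\<lambda>z. c {v, z}) ` {z \<in> nbrs T v. A v w z})"
  define F where "F u = conf u \<union> (if u \<in> set (take (d div 2) us) then Cv else Bv)" for u
  have fin: "finite Cv" "finite Bv" using finite_nbrs[OF simple, of v] by (auto simp: Cv_def Bv_def)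
  have cardC: "card Cv \<le> degree T v"
    using card_image_le[OF finite_nbrs[OF simple]] by (simp add: Cv_def degree_eq_card_nbrs[OF simple])
  have cardB: "card Bv \<le> degree T v div 2 + 1"
  proof -
    have "card ((\<lambda>z. c {v, z}) ` {z \<in> nbrs T v. A v w z}) \<le> card {z \<in> nbrs T v. A v w z}"
      using finite_nbrs[OF simple, of v] by (intro card_image_le) auto
    also have "\<dots> \<le> degree T v div 2" using out[OF v(1) wv] .
    finally show ?thesis
      unfolding Bv_def using finite_nbrs[OF simple, of v] by (simp add: card_insert_if)
  qed
  have BC: "Bv \<subseteq> Cv" using wv by (auto simp: Bv_def Cv_def)
  have degs: "d \<le> D" "degree T v \<le> D" "d + degree T v div 2 \<le> k" "degree T v + d div 2 \<le> k"
    using D w v \<open>S \<subseteq> verts T\<close> k_edge[of v w] k_edge[of w v] wv by (auto simp: d_def nbrs_def insert_commute)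
  \<comment> \<open>For \<open>d \<le> 8\<close> the lower bound \<open>kD\<close> absorbs the two colours in \<open>conf\<close>. For \<open>d > 8\<close> the at most
    two conflicting leaves are coloured right after the edges avoiding all colours at \<open>v\<close>.\<close>
  have bound: "finite (F (us ! i)) \<and> card (F (us ! i)) + i < card (L {w, us ! i})" if i: "i < length us" for i
  proof -
    let ?u = "us ! i"
    have uU: "?u \<in> U" using i us by auto
    have "k \<le> card (L {w, ?u})" using L U[OF uU] by blast
    moreover have "card (F ?u) + i < k"
    proof (cases "i < d div 2")
      case True
      have "card (F ?u) \<le> card (conf ?u) + degree T v"
        using cardC card_Un_le[of "conf ?u" Cv] card_Un_le[of "conf ?u" Bv] card_mono[OF fin(1) BC]
        unfolding F_def by (auto split: if_splits)
      moreover have "card (conf ?u) = 0" if "d > 8"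
        using usK[of i] that i True len conf0[OF uU] by (force simp flip: d_def)
      ultimately show ?thesis using True conf2(1)[of ?u] degs kD by linarith
    next
      case False
      have "?u \<notin> set (take (d div 2) us)"
        using False i us(1) by (auto simp: in_set_conv_nth nth_eq_iff_index_eq)
      then have "card (F ?u) \<le> card (conf ?u) + (degree T v div 2 + 1)"
        using cardB card_Un_le[of "conf ?u" Bv] unfolding F_def by auto
      moreover have "card (conf ?u) = 0" if "d > 8" "i > d div 2 + 1"
        using usK[of i] that i len conf0[OF uU] by (force simp flip: d_def)
      ultimately show ?thesis using False i conf2(1)[of ?u] degs kD len by linarith
    qed
    ultimately show ?thesis using fin conf2(2) by (simp add: F_def)
  qed
  obtain f where f: "inj_on f U" "\<And>u. u \<in> U \<Longrightarrow> f u \<in> L {w, u}" "\<And>u. u \<in> U \<Longrightarrow> f u \<notin> F u"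
    using greedy_choice[OF us(1) bound] us(2) by blast
  \<comment> \<open>The edge \<open>vw\<close> meets \<open>S\<close> and keeps its colour; among
    the tree edges exactly those from \<open>w\<close> to \<open>U\<close> are new.\<close>
  define c' where "c' e = (if e \<inter> S = {} \<and> w \<in> e then f (THE u. e = {w, u}) else c e)" for e
  define A' where "A' = A(w := Aw)"
  have old: "c' e = c e" if "e \<inter> S \<noteq> {}" for e using that by (simp add: c'_def)
  have new: "c' {w, u} = f u" if "u \<in> U" for u
  proof -
    have "(THE x. {w, u} = {w, x}) = u" by (auto simp: doubleton_eq_iff)
    then show ?thesis using U[OF that] w by (simp add: c'_def)
  qed
  have fB: "f u \<noteq> c {v, w}" "f u \<notin> conf u" if "u \<in> U" for u
    using f(3)[OF that] BC by (auto simp: F_def Bv_def split: if_splits)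
  have fA: "f u \<noteq> c {v, z}" if "u \<in> U" "z \<in> nbrs T v" "A v w z" for u z
  proof -
    have "c {v, z} \<in> Bv" using that by (auto simp: Bv_def)
    then show ?thesis using f(3)[OF that(1)] BC by (auto simp: F_def split: if_splits)
  qed
  have fC: "f u \<noteq> c {v, z}" if "u \<in> set (take (d div 2) us)" "z \<in> nbrs T v" for u z
  proof -
    have "u \<in> U" using that(1) us(2) by (metis in_set_takeD)
    then show ?thesis using f(3)[of u] that by (auto simp: F_def Cv_def)
  qed
  \<comment> \<open>A leaf in \<open>S\<close> has its neighbour in \<open>S\<close>, but
    \<open>w\<close> is a neighbour of \<open>v\<close> outside \<open>S\<close>; hence
    \<open>v\<close> is no leaf.\<close>
  have vleaf: "\<not> Q v u" for u
    using Q_leaf leaf v(1) wv w(2) by blast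
  have pair: "c' {w, u} \<noteq> c' {y, u'}" if "Q u u'" "w \<in> nbrs T u" "y \<in> S" "y \<in> nbrs T u'" for u u' y
  proof -
    have "u \<in> U" using that vleaf by (auto simp: U_def nbrs_sym)
    then have "c' {w, u} \<notin> conf u" using new fB(2) by simp
    moreover have "c' {y, u'} \<in> conf u" using old[of "{y, u'}"] conf[OF that(1,3,4)] that(3) by simp
    ultimately show ?thesis by metis
  qed
  have "partial (insert w S) c' A'"
    unfolding partial_def
  proof (intro conjI ballI allI impI)
    show "path_connected_set T (insert w S)" by (fact S')
  next
    fix u assume u: "u \<in> insert w S" "degree T u = 1"
    show "nbrs T u \<subseteq> insert w S"
    proof (cases "u = w")
      case True
      then have "card (nbrs T w) = 1" using u degree_eq_card_nbrs[OF simple] by metis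
      then show ?thesis using True v by (auto simp: card_1_singleton_iff)
    qed (use u leaf in auto)
  next
    fix e assume e: "e \<in> edges T" "e \<inter> insert w S \<noteq> {}"
    show "c' e \<in> L e"
    proof (cases "e \<inter> S = {}")
      case True
      then have "w \<in> e" "card e = 2" using e simple by (auto simp: simple_graph_def)
      then obtain u where u: "e = {w, u}" by (auto simp: card_2_iff doubleton_eq_iff)
      then have "u \<in> U" using e(1) True v by (auto simp: U_def nbrs_def)
      then show ?thesis using u new f(2) by simp
    qed (use old lists e in auto)
  next
    fix x assume x: "x \<in> insert w S"
    show "inj_on (\<lambda>z. c' {x, z}) (nbrs T x)"
    proof (cases "x = w")
      case True
      have "c' {w, v} = c {v, w}" using old[of "{w, v}"] v by (simp add: insert_commute)
      moreover have "inj_on (\<lambda>z. c' {w, z}) U" using f(1) new by (simp add: inj_on_def)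
      ultimately show ?thesis
        using True Uw new fB(1) by (force simp: inj_on_insert)
    qed (use x inj old in \<open>auto simp: inj_on_def\<close>)
  next
    fix x y z assume "x \<in> insert w S" "y \<in> nbrs T x" "z \<in> nbrs T x" "y \<noteq> z"
    then show "A' x y z \<or> A' x z y"
      using Aw(1) total[of x y z] w by (auto simp: A'_def)
  next
    fix x y assume "x \<in> insert w S" "y \<in> nbrs T x"
    then show "card {z \<in> nbrs T x. A' x y z} \<le> degree T x div 2"
      using Aw(2) out w by (auto simp: A'_def d_def)
  next
    fix b y z x
    assume h: "b \<in> insert w S" "y \<in> nbrs T b" "z \<in> nbrs T b" "x \<in> nbrs T y" "A' b y z" "y \<noteq> z" "x \<noteq> b"
      "y \<in> insert w S \<or> x \<in> insert w S"
    show "c' {y, x} \<noteq> c' {b, z}"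
    proof (cases "b = w")
      case True
      \<comment> \<open>For \<open>y\<close> in \<open>U\<close> the other end \<open>x\<close>
        would have to lie in \<open>S\<close>, which \<open>far\<close> excludes. So
        \<open>y = v\<close> remains, where the first half of \<open>us\<close> avoids all of
        \<open>Cv\<close>.\<close>
      have "y \<notin> U"
      proof
        assume y: "y \<in> U"
        then have "x \<in> S" using h True U by auto
        then show False using far U[OF y] h by blast
      qed
      then have "y = v" using h True Uw by auto
      then have "z \<in> U" "Aw v z" using h True Uw by (auto simp: A'_def)
      then have "f z \<noteq> c {v, x}"
        using fC[OF Aw(3)[rule_format, of z], of x] h(4) \<open>y = v\<close> by blast
      moreover have "c' {w, z} = f z" using new \<open>z \<in> U\<close> by blast
      moreover have "c' {v, x} = c {v, x}" using old[of "{v, x}"] v(1) by simp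
      ultimately show ?thesis using True \<open>y = v\<close> by simp
    next
      case False
      then have b: "b \<in> S" "A b y z" using h by (auto simp: A'_def)
      then have cb: "c' {b, z} = c {b, z}" using old by auto
      show ?thesis
      \<comment> \<open>If neither end lies in \<open>S\<close>, then \<open>w\<close> is an end of
        the edge. Either \<open>y = w\<close>, where \<open>b = v\<close> and the new colours avoid
        \<open>Bv\<close>, or \<open>x = w\<close>, where \<open>y\<close> would be adjacent to both
        \<open>w\<close> and \<open>S\<close>.\<close>
      proof (cases "y \<in> S \<or> x \<in> S")
        case True
        then show ?thesis using old[of "{y, x}"] cb forbid[OF b(1) h(2,3,4) b(2) h(6,7)] by auto
      next
        case nS: False
        show ?thesis
        proof (cases "y = w")
          case True
          then have "b = v" using uniq b h(2) by (simp add: nbrs_sym)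
          then have "x \<in> U" using True h by (auto simp: U_def)
          then show ?thesis using new cb fA[of x z] b h(3) True \<open>b = v\<close> by auto
        next
          case False
          then have "x = w" using h nS by auto
          then show ?thesis using far[of y b] nS False h b by (auto simp: nbrs_sym)
        qed
      qed
    qed
  next
    fix u u' x y
    assume h: "Q u u'" "x \<in> insert w S \<inter> nbrs T u" "y \<in> insert w S \<inter> nbrs T u'"
    then have Q': "Q u' u" using Q_sym by blast
    consider "x \<in> S" "y \<in> S" | "x = w" "y = w" | "x = w" "y \<in> S" | "x \<in> S" "y = w" using h by blast
    then show "c' {x, u} \<noteq> c' {y, u'}"
    proof cases
      case 1
      then show ?thesis using old[of "{x, u}"] old[of "{y, u'}"] leafpair[OF h(1)] h by auto
    next
      case 2
      then have "u \<in> U" "u' \<in> U" "u \<noteq> u'" using h Q' vleaf Q_irrefl by (auto simp: U_def nbrs_sym)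
      then show ?thesis using 2 new f(1) by (auto simp: inj_on_def)
    next
      case 3
      then show ?thesis using pair h by blast
    next
      case 4
      then show ?thesis using pair[OF Q'] h by (metis IntE)
    qed
  qed
  then show ?thesis using w by blast
qed

lemma partial_all:
  assumes "r \<in> verts T" "degree T r \<ge> 2"
  shows "\<exists>c A. partial (verts T) c A"
proof -
  have "\<exists>c A. partial (verts T) c A" if "partial S c A" for S c A
    using that
  proof (induction "card (verts T - S)" arbitrary: S c A rule: less_induct)
    case less
    show ?case
    proof (cases "S = verts T")
      case False
      then obtain w c' A' where w: "w \<in> verts T - S" "partial (insert w S) c' A'"
        using partial_step less.prems by blast
      have "finite (verts T)" using simple by (simp add: simple_graph_def)
      then have "card (verts T - insert w S) < card (verts T - S)"
        using w by (intro psubset_card_mono) auto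
      then show ?thesis using less.hyps w by blast
    qed (use less.prems in blast)
  qed
  then show ?thesis using partial_start[OF assms] by blast
qed

end

section \<open>Combining the tree and the cycle\<close>

text \<open>In a proper colouring, two colours on four consecutive edges must alternate. A
  four-cycle is the walk \<open>abcde\<close> with \<open>e = a\<close>, so one condition on walks
  serves paths and cycles.\<close>

lemma star_edge_coloringI:
  assumes proper: "proper_edge_coloring G \<phi>"
    and alt: "\<And>a b c d e. \<lbrakk>{a, b} \<in> edges G; {b, c} \<in> edges G; {c, d} \<in> edges G; {d, e} \<in> edges G;
      a \<noteq> c; b \<noteq> d; c \<noteq> e; \<phi> {a, b} = \<phi> {c, d}; \<phi> {b, c} = \<phi> {d, e}\<rbrakk> \<Longrightarrow> False"
  shows "star_edge_coloring G \<phi>"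
proof -
  have bi: "w = y \<and> x = z" if "card {w, x, y, z} = 2" "w \<noteq> x" "x \<noteq> y" "y \<noteq> z" for w x y z :: nat
    using that by (auto simp: card_insert_if split: if_splits)
  have no: False
    if e: "{a, b} \<in> edges G" "{b, c} \<in> edges G" "{c, d} \<in> edges G" "{d, e} \<in> edges G"
      and d: "a \<noteq> c" "b \<noteq> d" "c \<noteq> e"
      and two: "card {\<phi> {a, b}, \<phi> {b, c}, \<phi> {c, d}, \<phi> {d, e}} = 2" for a b c d e
  proof -
    have "\<phi> {a, b} \<noteq> \<phi> {b, c}" "\<phi> {b, c} \<noteq> \<phi> {c, d}" "\<phi> {c, d} \<noteq> \<phi> {d, e}"
      using proper e d unfolding proper_edge_coloring_def
      by (metis disjoint_insert(2) doubleton_eq_iff insertI1 insert_commute)+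
    then show False using bi[OF two] alt[OF e d] by blast
  qed
  show ?thesis
    unfolding star_edge_coloring_def
  proof (intro conjI allI impI notI)
    fix vs assume vs: "path_in G vs \<and> length vs = 5" "bichromatic \<phi> (path_edges vs)"
    then obtain a b c d e where "vs = [a, b, c, d, e]"
      by (auto simp: length_Suc_conv numeral_eq_Suc)
    then show False
      using vs no[of a b c d e] by (auto simp: path_in_def walk_def bichromatic_def)
  next
    fix vs assume vs: "cycle_in G vs \<and> length vs = 4" "bichromatic \<phi> (cycle_edges vs)"
    then obtain a b c d where "vs = [a, b, c, d]"
      by (auto simp: length_Suc_conv numeral_eq_Suc)
    then show False
      using vs no[of a b c d a]
      by (auto simp: cycle_in_def path_in_def walk_def bichromatic_def cycle_edges_def insert_commute)
  qed (fact proper)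
qed

text \<open>A bichromatic walk \<open>abcde\<close> either turns at \<open>c\<close> inside the tree, or lies in the cycle, or runs
  through one of the patterns tree-cycle-cycle and tree-cycle-tree.\<close>

lemma star_edge_coloring_tree_cycle:
  fixes T H :: "'a graph" and Q :: "'a \<Rightarrow> 'a \<Rightarrow> bool"
  assumes H: "simple_graph H" "\<And>u v. {u, v} \<in> edges H \<longleftrightarrow> u \<in> nbrs T v \<or> Q u v"
    and Q_sym: "\<And>u v. Q u v \<Longrightarrow> Q v u"
    and leaf: "\<And>u v. Q u v \<Longrightarrow> nbrs T u = {par u}"
    and inj: "\<And>v. inj_on (\<lambda>z. \<phi> {v, z}) (nbrs T v)"
    and total: "\<And>v y z. y \<in> nbrs T v \<Longrightarrow> z \<in> nbrs T v \<Longrightarrow> y \<noteq> z \<Longrightarrow> A v y z \<or> A v z y"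
    and forbid: "\<And>v y z x. y \<in> nbrs T v \<Longrightarrow> z \<in> nbrs T v \<Longrightarrow> y \<noteq> z \<Longrightarrow> x \<noteq> v \<Longrightarrow> {y, x} \<in> edges H \<Longrightarrow>
      A v y z \<Longrightarrow> \<phi> {y, x} \<noteq> \<phi> {v, z}"
    and TCT: "\<And>u v. Q u v \<Longrightarrow> \<phi> {par u, u} \<noteq> \<phi> {par v, v}"
    and TC: "\<And>u v. Q u v \<Longrightarrow> \<phi> {u, v} \<noteq> \<phi> {par u, u}"
    and TCC: "\<And>u v x. Q u v \<Longrightarrow> Q v x \<Longrightarrow> u \<noteq> x \<Longrightarrow> \<phi> {v, x} \<noteq> \<phi> {par u, u}"
    and CC: "\<And>u v x. Q u v \<Longrightarrow> Q v x \<Longrightarrow> u \<noteq> x \<Longrightarrow> \<phi> {u, v} \<noteq> \<phi> {v, x}"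
    and CCCC: "\<And>a b c d e. Q a b \<Longrightarrow> Q b c \<Longrightarrow> Q c d \<Longrightarrow> Q d e \<Longrightarrow> a \<noteq> c \<Longrightarrow> b \<noteq> d \<Longrightarrow> c \<noteq> e \<Longrightarrow>
      \<not> (\<phi> {a, b} = \<phi> {c, d} \<and> \<phi> {b, c} = \<phi> {d, e})"
  shows "star_edge_coloring H \<phi>"
proof (rule star_edge_coloringI)
  have par: "\<phi> {u, x} = \<phi> {par u, u}" if "Q u v" "x \<in> nbrs T u" for u v x
    using leaf[OF that(1)] that(2) by (simp add: insert_commute)
  show "proper_edge_coloring H \<phi>"
    unfolding proper_edge_coloring_def
  proof (intro ballI impI)
    fix e f assume ef: "e \<in> edges H" "f \<in> edges H" "e \<noteq> f \<and> e \<inter> f \<noteq> {}"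
    then obtain v where v: "v \<in> e" "v \<in> f" by blast
    have "\<exists>a. e = {v, a}" if "e \<in> edges H" "v \<in> e" for e
    proof -
      have "card e = 2" using that H(1) by (auto simp: simple_graph_def)
      then show ?thesis using that(2) by (auto simp: card_2_iff doubleton_eq_iff)
    qed
    then obtain a b where ab: "e = {v, a}" "f = {v, b}" using ef v by metis
    have aH: "a \<in> nbrs T v \<or> Q v a" and bH: "b \<in> nbrs T v \<or> Q v b"
      using H(2)[of v a] H(2)[of v b] ef ab by (auto simp: nbrs_sym)
    have ne: "a \<noteq> b" using ef ab by auto
    consider "a \<in> nbrs T v" "b \<in> nbrs T v" | "a \<in> nbrs T v" "Q v b" | "Q v a" "b \<in> nbrs T v"
      | "Q v a" "Q v b" using aH bH by blast
    then show "\<phi> e \<noteq> \<phi> f"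
    proof cases
      case 1
      then show ?thesis using inj[of v] ne ab by (auto dest: inj_onD)
    next
      case 2
      then show ?thesis using par[OF 2(2,1)] TC[OF 2(2)] ab by metis
    next
      case 3
      then show ?thesis using par[OF 3(1,2)] TC[OF 3(1)] ab by metis
    next
      case 4
      then show ?thesis using CC[OF Q_sym[OF 4(1)] 4(2) ne] ab by (metis insert_commute)
    qed
  qed
next
  fix a b c d e
  assume h: "{a, b} \<in> edges H" "{b, c} \<in> edges H" "{c, d} \<in> edges H" "{d, e} \<in> edges H"
    and ne: "a \<noteq> c" "b \<noteq> d" "c \<noteq> e" and eq: "\<phi> {a, b} = \<phi> {c, d}" "\<phi> {b, c} = \<phi> {d, e}"
  have par: "\<phi> {u, x} = \<phi> {par u, u}" "\<phi> {x, u} = \<phi> {par u, u}" if "Q u v" "x \<in> nbrs T u" for u v x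
    using leaf[OF that(1)] that(2) by (simp_all add: insert_commute)
  \<comment> \<open>Both middle edges are tree edges at \<open>c\<close>. Whichever way
    \<open>A c\<close> orients \<open>b\<close> and \<open>d\<close>, \<open>forbid\<close> excludes
    one of the two equalities.\<close>
  have turn: False
    if h: "{a, b} \<in> edges H" "b \<in> nbrs T c" "d \<in> nbrs T c" "{d, e} \<in> edges H"
      and ne: "a \<noteq> c" "b \<noteq> d" "c \<noteq> e" and eq: "\<phi> {a, b} = \<phi> {c, d}" "\<phi> {b, c} = \<phi> {d, e}" for a b c d e
    using total[OF h(2,3) ne(2)] forbid[OF h(2,3) ne(2,1)] forbid[OF h(3,2) ne(2)[symmetric] ne(3)[symmetric]]
      h(1,4) eq by (auto simp: insert_commute)
  \<comment> \<open>\<open>cd\<close> is the tree edge of the leaf \<open>c\<close>;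
    \<open>ab\<close> is either the next cycle edge, excluded by \<open>TCC\<close>, or the tree
    edge of \<open>b\<close>, excluded by \<open>TCT\<close>.\<close>
  have mixed: False
    if h: "Q b c" "d \<in> nbrs T c" "{a, b} \<in> edges H"
      and ne: "a \<noteq> c" and eq: "\<phi> {a, b} = \<phi> {c, d}" for a b c d
  proof (cases "Q a b")
    case True
    then show False using TCC[OF Q_sym[OF h(1)] Q_sym[OF True]] ne eq par[OF Q_sym[OF h(1)] h(2)]
      by (metis insert_commute)
  next
    case False
    then have "a \<in> nbrs T b" using h(3) H(2) by blast
    then show False using TCT[OF h(1)] par[OF h(1)] par[OF Q_sym[OF h(1)] h(2)] eq by metis
  qed
  have straight: False
    if h: "a \<in> nbrs T b" "Q b c" "Q c d" and ne: "b \<noteq> d" and eq: "\<phi> {a, b} = \<phi> {c, d}" for a b c d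
    using TCC[OF h(2,3) ne] par[OF h(2,1)] eq by metis
  consider "b \<in> nbrs T c" "d \<in> nbrs T c" | "Q b c" "d \<in> nbrs T c" | "b \<in> nbrs T c" "Q c d"
    | "Q b c" "Q c d" using h H(2) nbrs_sym by metis
  then show False
  proof cases
    case 1
    then show False using turn h ne eq by blast
  next
    case 2
    then show False using mixed h ne eq by blast
  next
    case 3
    then show False
      using mixed[OF Q_sym[OF 3(2)] 3(1), of e] h(4) ne eq by (metis insert_commute)
  next
    case 4
    show False
    proof (cases "Q a b")
      case ab: True
      show False
      proof (cases "Q d e")
        case False
        then have "e \<in> nbrs T d" using h(4) H(2) nbrs_sym by metis
        then show False
          using straight[OF _ Q_sym[OF 4(2)] Q_sym[OF 4(1)]] ne eq by (metis insert_commute)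
      qed (use CCCC ab 4 ne eq in blast)
    next
      case False
      then have "a \<in> nbrs T b" using h(1) H(2) by blast
      then show False using straight 4 ne eq by blast
    qed
  qed
qed

text \<open>Reducing indices modulo the length puts the closing edge on the same footing as the
  others.\<close>

lemma cycle_edges_iff:
  assumes "cs \<noteq> []"
  shows "e \<in> cycle_edges cs \<longleftrightarrow>
    (\<exists>i. e = {cs ! (i mod length cs), cs ! (Suc i mod length cs)})"
proof
  assume "e \<in> cycle_edges cs"
  then consider "e = {last cs, hd cs}" | i where "e = {cs ! i, cs ! Suc i}" "Suc i < length cs"
    by (auto simp: cycle_edges_def path_edges_def)
  then show "\<exists>i. e = {cs ! (i mod length cs), cs ! (Suc i mod length cs)}"
  proof cases
    case 1
    then show ?thesis
      using assms by (intro exI[of _ "length cs - 1"]) (auto simp: last_conv_nth hd_conv_nth)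
  next
    case 2
    then show ?thesis by (intro exI[of _ i]) auto
  qed
next
  assume "\<exists>i. e = {cs ! (i mod length cs), cs ! (Suc i mod length cs)}"
  then obtain i where e: "e = {cs ! (i mod length cs), cs ! (Suc (i mod length cs) mod length cs)}"
    by (auto simp: mod_Suc_eq)
  define j where "j = i mod length cs"
  have "j < length cs" using assms by (simp add: j_def)
  then consider "Suc j < length cs" | "Suc j = length cs" by linarith
  then show "e \<in> cycle_edges cs"
  proof cases
    case 1
    then show ?thesis using e by (auto simp: cycle_edges_def path_edges_def j_def[symmetric])
  next
    case 2
    then have "j = length cs - 1" by simp
    then show ?thesis
      using e 2 assms by (auto simp: cycle_edges_def j_def[symmetric] last_conv_nth hd_conv_nth)
  qed
qed

section \<open>Cyclic indexing of the adjoint cycle\<close>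

locale cyclic_list =
  fixes cs :: "'a list"
  assumes dist: "distinct cs" and len: "length cs \<ge> 3"
begin

text \<open>All naturals serve as indices, so taking successors needs no case distinction at the
  end; equality of vertices becomes congruence modulo the length.\<close>

definition g :: "nat \<Rightarrow> 'a" where "g i = cs ! (i mod length cs)"

definition Q :: "'a \<Rightarrow> 'a \<Rightarrow> bool" where "Q u v \<longleftrightarrow> {u, v} \<in> cycle_edges cs"

lemma n0: "0 < length cs" and ne: "cs \<noteq> []" using len by auto

lemma g_eq_iff: "g i = g j \<longleftrightarrow> i mod length cs = j mod length cs"
  using dist n0 by (simp add: g_def nth_eq_iff_index_eq)

lemma g_Suc_eq_iff: "g (Suc i) = g (Suc j) \<longleftrightarrow> g i = g j"
  by (auto simp: g_eq_iff mod_Suc)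

lemma edge_iff: "e \<in> cycle_edges cs \<longleftrightarrow> (\<exists>i. e = {g i, g (Suc i)})"
  unfolding g_def by (rule cycle_edges_iff[OF ne])

lemma Q_sym: "Q u v \<Longrightarrow> Q v u"
  by (simp add: Q_def insert_commute)

lemma g_in: "g i \<in> set cs" using n0 by (simp add: g_def)

lemma g_less: "i < length cs \<Longrightarrow> g i = cs ! i" by (simp add: g_def)

lemma g_add_length: "g (i + length cs) = g i"
  by (simp add: g_def)

text \<open>The four extra successors leave room to walk four edges in either direction without
  subtraction.\<close>

lemma Q_cases:
  assumes "Q u v"
  obtains i where "u = g (Suc (Suc (Suc (Suc i))))" "v = g (Suc (Suc (Suc (Suc (Suc i)))))"
    | i where "u = g (Suc (Suc (Suc (Suc (Suc i)))))" "v = g (Suc (Suc (Suc (Suc i))))"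
proof -
  obtain i where "{u, v} = {g i, g (Suc i)}" using assms by (auto simp: Q_def edge_iff)
  moreover have "g i = g (i + 2 * length cs)" "g (Suc i) = g (Suc (i + 2 * length cs))"
    by (simp_all add: g_def mod_Suc)
  \<comment> \<open>Twice the length is at least 6, so the subtraction of 4 is exact.\<close>
  moreover define j where "j = i + 2 * length cs - 4"
  moreover have "i + 2 * length cs = Suc (Suc (Suc (Suc j)))"
    using len unfolding j_def by linarith
  ultimately have "{u, v} = {g (Suc (Suc (Suc (Suc j)))), g (Suc (Suc (Suc (Suc (Suc j)))))}" by metis
  then show ?thesis using that by (auto simp: doubleton_eq_iff)
qed

lemma g_Suc_neq: "g i \<noteq> g (Suc i)"
  unfolding g_eq_iff using len by (simp add: mod_Suc)

lemma g_Suc_Suc_neq: "g i \<noteq> g (Suc (Suc i))"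
  unfolding g_eq_iff using len by (auto simp: mod_Suc split: if_splits)

lemma Q_irrefl: "\<not> Q u u"
  using Q_cases g_Suc_neq by metis

lemma Q_g: "Q (g (Suc i)) v \<longleftrightarrow> v = g i \<or> v = g (Suc (Suc i))"
proof
  assume "Q (g (Suc i)) v"
  then show "v = g i \<or> v = g (Suc (Suc i))"
    by (cases rule: Q_cases) (metis g_Suc_eq_iff)+
next
  assume "v = g i \<or> v = g (Suc (Suc i))"
  then show "Q (g (Suc i)) v" unfolding Q_def edge_iff by blast
qed

lemma Q_in: "Q u v \<Longrightarrow> u \<in> set cs"
  using Q_cases g_in by metis

lemma Q_nbrs:
  assumes "u \<in> set cs"
  obtains i where "u = g (Suc i)" "{v. Q u v} = {g i, g (Suc (Suc i))}"
proof -
  obtain j where j: "j < length cs" "u = cs ! j" using assms by (auto simp: in_set_conv_nth)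
  have "Suc (j + length cs - 1) = j + length cs" using len by linarith
  then have "u = g (Suc (j + length cs - 1))"
    using j(2) g_less[OF j(1)] g_add_length[of j] by metis
  then show ?thesis using that Q_g by blast
qed

lemma Q_card: "finite {v. Q u v}" "card {v. Q u v} \<le> 2"
proof -
  have "finite {v. Q u v} \<and> card {v. Q u v} \<le> 2"
  proof (cases "u \<in> set cs")
    case True
    then show ?thesis by (rule Q_nbrs) (simp add: card_insert_if)
  next
    case False
    then have "{v. Q u v} = {}" using Q_in by auto
    then show ?thesis by simp
  qed
  then show "finite {v. Q u v}" "card {v. Q u v} \<le> 2" by auto
qed

text \<open>Positions instead of cyclic indices, with the wrap at both ends spelled out: the
  separation argument compares positions linearly.\<close>

lemma Q_index:
  assumes "i < length cs" "Q (cs ! i) v"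
  obtains p where "p < length cs" "v = cs ! p" "p = Suc i \<or> Suc p = i \<or> (i = 0 \<and> Suc p = length cs) \<or> (p = 0 \<and> Suc i = length cs)"
proof -
  have *: "Suc (i + length cs - 1) = i + length cs" using len by linarith
  then have "g (Suc (i + length cs - 1)) = cs ! i"
    using g_less[OF assms(1)] g_add_length[of i] by metis
  then have "v = g (i + length cs - 1) \<or> v = g (Suc i)"
    using assms(2) Q_g[of "i + length cs - 1" v] g_add_length[of "Suc i"] * by simp
  then show ?thesis
  proof
    assume v: "v = g (Suc i)"
    show ?thesis
    proof (cases "Suc i < length cs")
      case False
      then have "Suc i = length cs" using assms(1) by simp
      then show ?thesis using v that[of 0] n0 by (simp add: g_def)
    qed (use v that[of "Suc i"] in \<open>simp add: g_less\<close>)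
  next
    assume v: "v = g (i + length cs - 1)"
    show ?thesis
    proof (cases i)
      case 0
      then show ?thesis using v n0 that[of "length cs - 1"] by (simp add: g_less)
    next
      case (Suc p)
      then have "v = g p" using v g_add_length[of p] by simp
      then show ?thesis using Suc assms(1) that[of p] by (simp add: g_less)
    qed
  qed
qed

text \<open>Equality with the ends exchanged would give \<open>g i = g (Suc (Suc i))\<close>,
  impossible in a cycle of length at least three.\<close>

lemma edge_eq_iff: "{g i, g (Suc i)} = {g j, g (Suc j)} \<longleftrightarrow> g i = g j"
  using g_Suc_eq_iff g_Suc_Suc_neq by (auto simp: doubleton_eq_iff) (metis g_Suc_eq_iff g_Suc_Suc_neq)+

end

lemma ex_less_less_of_card:
  fixes I :: "nat set"
  assumes "card I \<ge> 3"
  shows "\<exists>i\<in>I. \<exists>j\<in>I. \<exists>k\<in>I. i < j \<and> j < k"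
proof -
  have fin: "finite I" and ne: "I \<noteq> {}" using assms by (auto intro: card_ge_0_finite)
  have "I - {Min I, Max I} \<noteq> {}"
  proof
    assume "I - {Min I, Max I} = {}"
    then have "card I \<le> card {Min I, Max I}" by (intro card_mono) auto
    then show False using assms by (simp add: card_insert_if split: if_splits)
  qed
  then obtain j where j: "j \<in> I" "j \<noteq> Min I" "j \<noteq> Max I" by blast
  then have "Min I < j" "j < Max I" using fin by (simp_all add: le_neq_trans order_less_le)
  then show ?thesis using j(1) Min_in[OF fin ne] Max_in[OF fin ne] by blast
qed

section \<open>Planarity and the colouring of the whole graph\<close>

locale halin = cyclic_list cs for cs :: "'a list" +
  fixes T C :: "'a graph" and p :: "'a \<Rightarrow> complex" and \<gamma> :: "'a set \<Rightarrow> real \<Rightarrow> complex"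
  assumes halin: "generalized_halin T C p \<gamma>"
    and C: "C = Graph (set cs) (cycle_edges cs)"
begin

lemma tree: "tree T" and simple: "simple_graph T" and connected: "connected_graph T"
  using halin by (auto simp: generalized_halin_def tree_def)

lemma set_cs: "set cs = {v \<in> verts T. degree T v = 1}"
  using halin by (simp add: generalized_halin_def leaves_def C)

lemma leaf_nbrs: "u \<in> set cs \<Longrightarrow> x \<in> nbrs T u \<Longrightarrow> nbrs T u = {x}"
  using degree_eq_card_nbrs[OF simple, of u] set_cs by (auto simp: card_1_singleton_iff)

text \<open>A path in \<open>S\<close>, prolonged to the leaves \<open>cs ! a\<close> and
  \<open>cs ! b\<close>, is a walk that avoids \<open>w\<close> and its leaf neighbours
  \<open>cs ! i\<close> and \<open>cs ! j\<close>. Its ends lie on different arcs of the cycle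
  between these two, which \<open>halin_noncrossing\<close> forbids.\<close>

lemma separated:
  assumes S: "path_connected_set T S" "\<forall>u\<in>S. degree T u = 1 \<longrightarrow> nbrs T u \<subseteq> S"
    and w: "w \<in> verts T - S" "w \<notin> set cs"
    and ij: "i < a" "a < j" "j < length cs" "b < i \<or> j < b" "b < length cs"
    and u: "cs ! i \<in> nbrs T w" "cs ! j \<in> nbrs T w"
    and l: "nbrs T (cs ! a) \<inter> S \<noteq> {}" "nbrs T (cs ! b) \<inter> S \<noteq> {}"
  shows False
proof -
  obtain y z where yz: "y \<in> nbrs T (cs ! a)" "y \<in> S" "z \<in> nbrs T (cs ! b)" "z \<in> S" using l by blast
  then obtain vs where vs: "path_in T vs" "set vs \<subseteq> S" "hd vs = y" "last vs = z"
    using S(1) unfolding path_connected_set_def by meson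
  define ws where "ws = cs ! a # vs @ [cs ! b]"
  have vs0: "vs \<noteq> []" "walk T vs" using vs(1) by (auto simp: path_in_def walk_def)
  have inT: "cs ! k \<in> verts T" if "k < length cs" for k
    using set_cs nth_mem[OF that] by blast
  have "{cs ! a, y} \<in> edges T" "{z, cs ! b} \<in> edges T"
    using yz by (auto simp: nbrs_def insert_commute)
  then have walk: "walk T ws"
    using vs0 vs(3,4) inT[of a] inT[of b] ij
    by (auto simp: walk_def ws_def successively_append_iff successively_Cons)
  have leafS: "cs ! k \<notin> S" if "k < length cs" "cs ! k \<in> nbrs T w" for k
  proof
    assume k: "cs ! k \<in> S"
    have "degree T (cs ! k) = 1" using set_cs nth_mem[OF that(1)] by blast
    then have "w \<in> S" using S(2) k that(2) by (auto simp: nbrs_sym)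
    then show False using w by blast
  qed
  have dis: "cs ! k \<noteq> cs ! k'" if "k \<noteq> k'" "k < length cs" "k' < length cs" for k k'
    using dist that by (simp add: nth_eq_iff_index_eq)
  have "set ws \<inter> {w, cs ! i, cs ! j} = {}"
    using leafS[of i] leafS[of j] u ij vs(2) w nth_mem[of a cs] nth_mem[of b cs]
      dis[of i a] dis[of j a] dis[of i b] dis[of j b]
    by (auto simp: ws_def)
  moreover have split: "cs = take i cs @ cs ! i # take (j - Suc i) (drop (Suc i) cs) @ cs ! j # drop (Suc j) cs"
  proof -
    have "drop (Suc i) cs = take (j - Suc i) (drop (Suc i) cs) @ cs ! j # drop (Suc j) cs"
      using id_take_nth_drop[of "j - Suc i" "drop (Suc i) cs"] ij by simp
    then show ?thesis using id_take_nth_drop[of i cs] ij by simp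
  qed
  moreover have "hd ws \<in> set (take (j - Suc i) (drop (Suc i) cs))"
  proof -
    have "take (j - Suc i) (drop (Suc i) cs) ! (a - Suc i) = cs ! a"
      using ij by simp
    then show ?thesis
      using ij nth_mem[of "a - Suc i" "take (j - Suc i) (drop (Suc i) cs)"] by (simp add: ws_def)
  qed
  moreover have "last ws \<in> set (take i cs @ drop (Suc j) cs)"
  proof (cases "b < i")
    case True
    then show ?thesis using ij nth_mem[of b "take i cs"] by (simp add: ws_def)
  next
    case False
    then show ?thesis using ij nth_mem[of "b - Suc j" "drop (Suc j) cs"] by (simp add: ws_def)
  qed
  moreover have "{w, cs ! i} \<in> edges T" "{w, cs ! j} \<in> edges T" using u by (auto simp: nbrs_def)
  ultimately show False
    using halin_noncrossing[OF halin C dist split, of w ws] w walk by auto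
qed

text \<open>Of three conflicting leaf neighbours of \<open>w\<close>, the middle one has its partner
  strictly between it and one of the others. The partner of the third lies outside that interval,
  and both partners are linked through \<open>S\<close>, contrary to
  \<open>separated\<close>.\<close>

lemma card_conflicts:
  assumes S: "path_connected_set T S" "\<forall>u\<in>S. degree T u = 1 \<longrightarrow> nbrs T u \<subseteq> S"
    and w: "w \<in> verts T - S"
  shows "card {u \<in> nbrs T w. \<exists>u'. Q u u' \<and> nbrs T u' \<inter> S \<noteq> {}} \<le> 2" (is "card ?K \<le> 2")
proof (cases "w \<in> set cs")
  case True
  then have "card (nbrs T w) = 1"
    using set_cs degree_eq_card_nbrs[OF simple, of w] by auto
  moreover have "card ?K \<le> card (nbrs T w)"
    using finite_nbrs[OF simple] by (intro card_mono) auto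
  ultimately show ?thesis by simp
next
  case False
  show ?thesis
  proof (rule ccontr)
    assume K: "\<not> card ?K \<le> 2"
    define I where "I = {i. i < length cs \<and> cs ! i \<in> ?K}"
    have "?K \<subseteq> (!) cs ` I"
    proof
      fix u assume u: "u \<in> ?K"
      then have "u \<in> set cs" using Q_in by blast
      then show "u \<in> (!) cs ` I" using u by (auto simp: in_set_conv_nth I_def)
    qed
    moreover have "finite I" by (simp add: I_def)
    ultimately have "card I \<ge> 3" using K surj_card_le[of I ?K "(!) cs"] by simp
    then obtain i j k where ijk: "i \<in> I" "j \<in> I" "k \<in> I" "i < j" "j < k"
      using ex_less_less_of_card by meson
    have partner: "\<exists>q. q < length cs \<and> q \<notin> I \<and> nbrs T (cs ! q) \<inter> S \<noteq> {} \<and>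
        (q = Suc i \<or> Suc q = i \<or> (i = 0 \<and> Suc q = length cs) \<or> (q = 0 \<and> Suc i = length cs))"
      if iI: "i \<in> I" for i
    proof -
      obtain u' where u': "Q (cs ! i) u'" "nbrs T u' \<inter> S \<noteq> {}" using iI by (auto simp: I_def)
      have "i < length cs" using iI by (simp add: I_def)
      obtain q where q: "q < length cs" "u' = cs ! q"
          "q = Suc i \<or> Suc q = i \<or> (i = 0 \<and> Suc q = length cs) \<or> (q = 0 \<and> Suc i = length cs)"
        using Q_index[OF \<open>i < length cs\<close> u'(1)] by metis
      \<comment> \<open>The only neighbour of a partner lies in \<open>S\<close>, so a partner is
        not adjacent to \<open>w\<close>.\<close>
      have "q \<notin> I"
      proof
        assume "q \<in> I"
        then have "w \<in> nbrs T u'" using q by (auto simp: I_def nbrs_sym)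
        then have "nbrs T u' = {w}" using leaf_nbrs q nth_mem[OF q(1)] by metis
        then show False using u'(2) w by auto
      qed
      then show ?thesis using q u' by blast
    qed
    have nb: "cs ! i \<in> nbrs T w" "i < length cs" if "i \<in> I" for i using that by (auto simp: I_def)
    obtain qi where qi: "qi < length cs" "qi \<notin> I" "nbrs T (cs ! qi) \<inter> S \<noteq> {}"
        "qi = Suc i \<or> Suc qi = i \<or> (i = 0 \<and> Suc qi = length cs) \<or> (qi = 0 \<and> Suc i = length cs)"
      using partner[OF ijk(1)] by blast
    obtain qj where qj: "qj < length cs" "qj \<notin> I" "nbrs T (cs ! qj) \<inter> S \<noteq> {}"
        "qj = Suc j \<or> Suc qj = j \<or> (j = 0 \<and> Suc qj = length cs) \<or> (qj = 0 \<and> Suc j = length cs)"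
      using partner[OF ijk(2)] by blast
    obtain qk where qk: "qk < length cs" "qk \<notin> I" "nbrs T (cs ! qk) \<inter> S \<noteq> {}"
        "qk = Suc k \<or> Suc qk = k \<or> (k = 0 \<and> Suc qk = length cs) \<or> (qk = 0 \<and> Suc k = length cs)"
      using partner[OF ijk(3)] by blast
    have ne: "q \<noteq> i" "q \<noteq> j" "q \<noteq> k" if "q \<notin> I" for q using ijk that by auto
    \<comment> \<open>\<open>j\<close> is neither the first nor the last position, so its partner
      does not wrap around.\<close>
    have "qj = Suc j \<or> Suc qj = j" using qj(4) ijk nb(2)[OF ijk(3)] by linarith
    then show False
    proof
      assume "Suc qj = j"
      then have "i < qj" "qj < j" using ne[OF qj(2)] ijk by linarith+
      moreover have "qk < i \<or> j < qk"
        using qk(4) ne[OF qk(2)] ijk by linarith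
      ultimately show False
        using separated[OF S w False _ _ _ _ qk(1) nb(1)[OF ijk(1)] nb(1)[OF ijk(2)] qj(3) qk(3)] nb(2)[OF ijk(2)]
        by blast
    next
      assume "qj = Suc j"
      then have "j < qj" "qj < k" using ne[OF qj(2)] ijk by linarith+
      moreover have "qi < j \<or> k < qi"
        using qi(1,4) ne[OF qi(2)] ijk nb(2)[OF ijk(3)] by linarith
      ultimately show False
        using separated[OF S w False _ _ _ _ qi(1) nb(1)[OF ijk(2)] nb(1)[OF ijk(3)] qj(3) qi(3)] nb(2)[OF ijk(3)]
        by blast
    qed
  qed
qed

section \<open>Degree bounds, and disjointness of tree and cycle edges\<close>

lemma degree_le: "v \<in> verts T \<Longrightarrow> degree T v \<le> max_degree T"
  using simple by (simp add: max_degree_def simple_graph_def)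

lemma edge_degree_le: "{v, w} \<in> edges T \<Longrightarrow> degree T v + degree T w \<le> max_edge_degree_sum T"
proof -
  assume e: "{v, w} \<in> edges T"
  let ?D = "{degree T x + degree T y | x y. {x, y} \<in> edges T}"
  have "?D \<subseteq> (\<lambda>(x, y). degree T x + degree T y) ` (verts T \<times> verts T)"
    using simple by (fastforce simp: simple_graph_def)
  then have "finite ?D"
    using simple by (meson finite_SigmaI finite_imageI finite_subset simple_graph_def)
  then show ?thesis
    unfolding max_edge_degree_sum_def using e by (intro Max_ge) auto
qed

lemma ex_branch_vertex: "\<exists>r\<in>verts T. degree T r \<ge> 3"
proof -
  have "finite (verts T)" "verts T \<noteq> {}"
    using simple connected by (auto simp: simple_graph_def connected_graph_def)
  then have "max_degree T \<in> degree T ` verts T"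
    unfolding max_degree_def by (intro Max_in) auto
  then show ?thesis using halin by (auto simp: generalized_halin_def)
qed

text \<open>Such an edge would join two leaves and be a whole component of \<open>T\<close>, but
  \<open>T\<close> also has a vertex of degree at least three.\<close>

lemma tree_edge_not_cycle_edge:
  assumes "z \<in> nbrs T v"
  shows "{v, z} \<notin> cycle_edges cs"
proof
  assume "{v, z} \<in> cycle_edges cs"
  then have vz: "v \<in> set cs" "z \<in> set cs" using Q_in Q_sym by (auto simp: Q_def)
  then have n: "nbrs T v = {z}" "nbrs T z = {v}" using assms leaf_nbrs nbrs_sym by metis+
  obtain r where r: "r \<in> verts T" "degree T r \<ge> 3" using ex_branch_vertex by blast
  then have "r \<notin> {v, z}" using vz set_cs by auto
  then have "\<exists>w\<in>verts T - {v, z}. nbrs T w \<inter> {v, z} \<noteq> {}"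
    using vz set_cs r by (intro connected_exit[OF connected]) auto
  then show False using n by (auto simp: nbrs_sym)
qed

text \<open>After the tree is coloured, each cycle edge loses at most four colours to tree edges at
  nearby leaves and \<open>max_degree T div 2\<close> for each end to the tournament at its tree
  neighbour. Three colours are left, and the cycle result applies.\<close>

lemma star_edge_choosable:
  assumes "length cs \<noteq> 5"
    and k: "k = max ((max_edge_degree_sum T + max_degree T) div 2) (2 * (max_degree T div 2) + 7)"
  shows "star_edge_choosable (graph_union T C) k"
  unfolding star_edge_choosable_def
proof (intro allI impI)
  fix L :: "'a set \<Rightarrow> nat set"
  assume LH: "\<forall>e\<in>edges (graph_union T C). finite (L e) \<and> k \<le> card (L e)"
  let ?n = "length cs"
  have EH: "edges (graph_union T C) = edges T \<union> cycle_edges cs"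
    by (simp add: graph_union_def C)
  interpret tree_colouring T L k "max_degree T" Q
  proof
    \<comment> \<open>Both degrees together are at most the edge degree sum, and
      \<open>degree T w\<close> alone at most the maximum degree; the total is then halved.\<close>
    show "degree T w + degree T v div 2 \<le> k" if "{v, w} \<in> edges T" for v w
    proof -
      have "w \<in> verts T" using that simple by (auto simp: simple_graph_def)
      then have "2 * degree T w + degree T v \<le> max_edge_degree_sum T + max_degree T"
        using edge_degree_le[OF that] degree_le by fastforce
      then show ?thesis unfolding k by linarith
    qed
    show "degree T u = 1" if "Q u u'" for u u' using Q_in[OF that] set_cs by blast
    show "k \<le> card (L e)" if "e \<in> edges T" for e using that LH EH by simp
    show "2 * (max_degree T div 2) + 7 \<le> k" using k by simp
  qed (fact tree degree_le Q_sym Q_irrefl Q_card card_conflicts)+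
  obtain r where "r \<in> verts T" "degree T r \<ge> 2" using ex_branch_vertex by fastforce
  then obtain c A where "partial (verts T) c A" using partial_all by blast
  note pS = this[unfolded partial_def]
  have cL: "c e \<in> L e" if "e \<in> edges T" for e
  proof -
    have "e \<subseteq> verts T" "card e = 2" using simple that by (auto simp: simple_graph_def)
    then have "e \<inter> verts T \<noteq> {}" by (auto simp: Int_absorb2)
    then show ?thesis using pS[THEN conjunct2, THEN conjunct2, THEN conjunct1] that by simp
  qed
  have inj: "\<And>v. v \<in> verts T \<Longrightarrow> inj_on (\<lambda>z. c {v, z}) (nbrs T v)"
    and total: "\<And>v y z. v \<in> verts T \<Longrightarrow> y \<in> nbrs T v \<Longrightarrow> z \<in> nbrs T v \<Longrightarrow> y \<noteq> z \<Longrightarrow> A v y z \<or> A v z y"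
    using pS by auto
  have nV: "v \<in> verts T" "y \<in> verts T" if "y \<in> nbrs T v" for v y
    using nbrs_simple[OF simple that] by auto
  have forbid: "c {y, x} \<noteq> c {v, z}"
    if h: "y \<in> nbrs T v" "z \<in> nbrs T v" "x \<in> nbrs T y" "A v y z" "y \<noteq> z" "x \<noteq> v" for v y z x
  proof -
    have "\<forall>v\<in>verts T. \<forall>y\<in>nbrs T v. \<forall>z\<in>nbrs T v. \<forall>x\<in>nbrs T y.
       A v y z \<longrightarrow> y \<noteq> z \<longrightarrow> x \<noteq> v \<longrightarrow> y \<in> verts T \<or> x \<in> verts T \<longrightarrow> c {y, x} \<noteq> c {v, z}"
      using pS by (elim conjE)
    then show ?thesis using h nV[OF h(1)] by simp
  qed
  have out: "card {z \<in> nbrs T v. A v y z} \<le> degree T v div 2" if "y \<in> nbrs T v" for v y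
  proof -
    have "\<forall>v\<in>verts T. \<forall>y\<in>nbrs T v. card {z \<in> nbrs T v. A v y z} \<le> degree T v div 2"
      using pS by (elim conjE)
    then show ?thesis using that nV[OF that] by simp
  qed
  have leafpair: "c {x, u} \<noteq> c {y, u'}" if h: "Q u u'" "x \<in> nbrs T u" "y \<in> nbrs T u'" for u u' x y
  proof -
    have "\<forall>u u' x y. Q u u' \<longrightarrow> x \<in> verts T \<inter> nbrs T u \<longrightarrow> y \<in> verts T \<inter> nbrs T u' \<longrightarrow> c {x, u} \<noteq> c {y, u'}"
      using pS by (elim conjE)
    then show ?thesis using h nV[OF h(2)] nV[OF h(3)] by simp
  qed
  define par where "par u = (THE x. x \<in> nbrs T u)" for u
  have par: "nbrs T u = {par u}" if u: "u \<in> set cs" for u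
  proof -
    obtain x where x: "nbrs T u = {x}"
      using u set_cs degree_eq_card_nbrs[OF simple, of u] by (auto simp: card_1_singleton_iff)
    then have "par u = x" unfolding par_def by auto
    then show ?thesis using x by simp
  qed
  have parI: "par u \<in> nbrs T u" "u \<in> nbrs T (par u)" if "u \<in> set cs" for u
    using par[OF that] nbrs_sym by (metis insertI1)+
  \<comment> \<open>Colours forbidden on the cycle edges at the leaf \<open>u\<close> by the
    tournament at its tree neighbour.\<close>
  define Forb where "Forb u = (\<lambda>z. c {par u, z}) ` {z \<in> nbrs T (par u). A (par u) u z}" for u
  have Forb: "finite (Forb u) \<and> card (Forb u) \<le> max_degree T div 2" if "u \<in> set cs" for u
  proof -
    note u = parI(2)[OF that]
    have fin: "finite {z \<in> nbrs T (par u). A (par u) u z}" using finite_nbrs[OF simple, of "par u"] by simp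
    have "degree T (par u) \<le> max_degree T" using u nbrs_simple(2)[OF simple] degree_le by blast
    then show ?thesis
      using card_image_le[OF fin, of "\<lambda>z. c {par u, z}"] out[OF u] fin
      unfolding Forb_def by (auto intro: order_trans dest: div_le_mono[of _ _ 2])
  qed
  define lc where "lc u = c {par u, u}" for u
  \<comment> \<open>\<open>F i\<close> belongs to the cycle edge from \<open>g (Suc i)\<close> to
    \<open>g (Suc (Suc i))\<close>. The tree edges at its ends rule out improper pairs, those one
    vertex further rule out tree-cycle-cycle patterns, and \<open>Forb\<close> handles paths that
    turn in the tree.\<close>
  define F where "F i = {lc (g i), lc (g (Suc i)), lc (g (Suc (Suc i))), lc (g (Suc (Suc (Suc i))))} \<union>
      Forb (g (Suc i)) \<union> Forb (g (Suc (Suc i)))" for i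
  define M where "M i = L {g (Suc i), g (Suc (Suc i))} - F i" for i
  have "card (M i) \<ge> 3" for i
  proof -
    let ?l = "{lc (g i), lc (g (Suc i)), lc (g (Suc (Suc i))), lc (g (Suc (Suc (Suc i))))}"
    have "card ?l \<le> 4" by (auto simp: card_insert_if)
    moreover have "card (F i) \<le> card ?l + card (Forb (g (Suc i))) + card (Forb (g (Suc (Suc i))))"
      unfolding F_def by (meson add_le_mono card_Un_le le_refl order_trans)
    ultimately have "card (F i) \<le> 4 + 2 * (max_degree T div 2)"
      using Forb[OF g_in[of "Suc i"]] Forb[OF g_in[of "Suc (Suc i)"]] by linarith
    moreover have "finite (F i)" using Forb[OF g_in] by (simp add: F_def)
    moreover have "{g (Suc i), g (Suc (Suc i))} \<in> edges (graph_union T C)"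
      using EH edge_iff by blast
    then have "2 * (max_degree T div 2) + 7 \<le> card (L {g (Suc i), g (Suc (Suc i))})" using LH k by auto
    ultimately show ?thesis
      unfolding M_def using diff_card_le_card_Diff[of "F i" "L {g (Suc i), g (Suc (Suc i))}"] by linarith
  qed
  then obtain f where f: "\<And>i. i < ?n \<Longrightarrow> f i \<in> M i" and sq: "square_free2 (\<lambda>i. f (i mod ?n))"
    using ex_cycle_colouring[OF len assms(1)] by blast
  define \<kappa> where "\<kappa> i = f (i mod ?n)" for i
  have gmod: "g (i mod ?n) = g i" for i by (simp add: g_eq_iff)
  have gS: "g (Suc i) = g (Suc j)" if "g i = g j" for i j using that g_Suc_eq_iff by blast
  have "M (i mod ?n) = M i" for i
  proof -
    note 1 = gmod[of i]
    note 2 = gS[OF 1]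
    note 3 = gS[OF 2]
    note 4 = gS[OF 3]
    show ?thesis unfolding M_def F_def 1 2 3 4 ..
  qed
  then have \<kappa>M: "\<kappa> i \<in> M i" for i using f[of "i mod ?n"] n0 by (simp add: \<kappa>_def)
  have \<kappa>L: "\<kappa> i \<in> L {g (Suc i), g (Suc (Suc i))}"
    and \<kappa>lc: "\<kappa> i \<noteq> lc (g i)" "\<kappa> i \<noteq> lc (g (Suc i))" "\<kappa> i \<noteq> lc (g (Suc (Suc i)))"
      "\<kappa> i \<noteq> lc (g (Suc (Suc (Suc i))))"
    and \<kappa>F: "\<kappa> i \<notin> Forb (g (Suc i))" "\<kappa> i \<notin> Forb (g (Suc (Suc i)))" for i
    using \<kappa>M[of i] by (auto simp: M_def F_def)
  have \<kappa>2: "\<kappa> i \<noteq> \<kappa> (Suc i)"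
    and \<kappa>4: "\<not> (\<kappa> i = \<kappa> (Suc (Suc i)) \<and> \<kappa> (Suc i) = \<kappa> (Suc (Suc (Suc i))))" for i
    using sq unfolding square_free2_def \<kappa>_def by (simp_all add: numeral_2_eq_2 numeral_3_eq_3)
  \<comment> \<open>Cycle edges are decoded to their index below the length, with the same offset by
    one as in \<open>F\<close>; tree edges keep \<open>c\<close>.\<close>
  define \<phi> where "\<phi> e = (if e \<in> cycle_edges cs
      then f (THE j. j < ?n \<and> e = {g (Suc j), g (Suc (Suc j))}) else c e)" for e
  have \<phi>T: "\<phi> {v, z} = c {v, z}" if "z \<in> nbrs T v" for v z
    using tree_edge_not_cycle_edge[OF that] by (simp add: \<phi>_def)
  have \<phi>C: "\<phi> {g (Suc i), g (Suc (Suc i))} = \<kappa> i" for i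
  proof -
    have "(THE j. j < ?n \<and> {g (Suc i), g (Suc (Suc i))} = {g (Suc j), g (Suc (Suc j))}) = i mod ?n"
      unfolding edge_eq_iff g_Suc_eq_iff unfolding g_eq_iff using n0 by (intro the_equality) auto
    moreover have "{g (Suc i), g (Suc (Suc i))} \<in> cycle_edges cs" using edge_iff by blast
    ultimately show ?thesis by (simp add: \<phi>_def \<kappa>_def)
  qed
  have \<phi>C': "\<phi> {g (Suc (Suc i)), g (Suc i)} = \<kappa> i" for i
    using \<phi>C[of i] by (simp add: insert_commute)
  have lc: "\<phi> {par u, u} = lc u" if "u \<in> set cs" for u
    using \<phi>T[OF parI(2)[OF that]] by (simp add: lc_def)
  \<comment> \<open>A walk on the cycle that does not turn back keeps its direction.\<close>
  have step: "Q (g (Suc i)) x \<Longrightarrow> x \<noteq> g i \<Longrightarrow> x = g (Suc (Suc i))"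
    "Q (g (Suc i)) x \<Longrightarrow> x \<noteq> g (Suc (Suc i)) \<Longrightarrow> x = g i" for i x
    using Q_g by blast+
  have QF: "\<phi> {u, v} \<notin> Forb u" if "Q u v" for u v
    using that by (cases rule: Q_cases) (simp_all add: \<phi>C \<phi>C' \<kappa>F)
  have "star_edge_coloring (graph_union T C) \<phi>"
  proof (rule star_edge_coloring_tree_cycle)
    show "simple_graph (graph_union T C)"
      using halin by (simp add: generalized_halin_def plane_graph_def)
    show "{u, v} \<in> edges (graph_union T C) \<longleftrightarrow> u \<in> nbrs T v \<or> Q u v" for u v
      by (simp add: EH nbrs_def Q_def insert_commute)
    show "Q v u" if "Q u v" for u v using that by (rule Q_sym)
    show "nbrs T u = {par u}" if "Q u v" for u v using par Q_in[OF that] .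
    show "inj_on (\<lambda>z. \<phi> {v, z}) (nbrs T v)" for v
    proof (cases "v \<in> verts T")
      case True
      then show ?thesis using inj \<phi>T by (simp add: inj_on_def)
    next
      case False
      then have "nbrs T v = {}" using nbrs_simple(2)[OF simple] by blast
      then show ?thesis by simp
    qed
    show "A v y z \<or> A v z y" if "y \<in> nbrs T v" "z \<in> nbrs T v" "y \<noteq> z" for v y z
      using total that nbrs_simple(2)[OF simple] by blast
    \<comment> \<open>If \<open>yx\<close> is a cycle edge, then \<open>y\<close> is a leaf with
      tree neighbour \<open>v\<close>, and the colour of \<open>vz\<close> lies in
      \<open>Forb y\<close>.\<close>
    show "\<phi> {y, x} \<noteq> \<phi> {v, z}"
      if h: "y \<in> nbrs T v" "z \<in> nbrs T v" "y \<noteq> z" "x \<noteq> v" "{y, x} \<in> edges (graph_union T C)" "A v y z"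
      for v y z x
    proof (cases "x \<in> nbrs T y")
      case True
      then show ?thesis using forbid[OF h(1,2) True h(6,3,4)] \<phi>T h(2) by simp
    next
      case False
      then have Q: "Q y x" using h(5) by (auto simp: EH nbrs_def Q_def)
      have "par y = v" using par[OF Q_in[OF Q]] h(1) nbrs_sym by (metis singletonD)
      then have "c {v, z} \<in> Forb y" using h by (auto simp: Forb_def)
      then show ?thesis using QF[OF Q] \<phi>T h(2) by metis
    qed
    show "\<phi> {par u, u} \<noteq> \<phi> {par v, v}" if "Q u v" for u v
      using leafpair[OF that parI(1)[OF Q_in[OF that]] parI(1)[OF Q_in[OF Q_sym[OF that]]]]
        lc[OF Q_in[OF that]] lc[OF Q_in[OF Q_sym[OF that]]] by (simp add: lc_def)
    show "\<phi> {u, v} \<noteq> \<phi> {par u, u}" if "Q u v" for u v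
      unfolding lc[OF Q_in[OF that]]
      using that by (cases rule: Q_cases) (simp_all add: \<phi>C \<phi>C' \<kappa>lc)
    show "\<phi> {v, x} \<noteq> \<phi> {par u, u}" if "Q u v" "Q v x" "u \<noteq> x" for u v x
      using that(1)
    proof (cases rule: Q_cases)
      case (1 i)
      have x: "x = g (Suc (Suc (Suc (Suc (Suc (Suc i))))))" using step(1) 1 that(2,3) by metis
      show ?thesis unfolding lc[OF Q_in[OF that(1)]] unfolding 1 x \<phi>C by (rule \<kappa>lc)
    next
      case (2 i)
      have x: "x = g (Suc (Suc (Suc i)))" using step(2) 2 that(2,3) by metis
      show ?thesis unfolding lc[OF Q_in[OF that(1)]] unfolding 2 x \<phi>C' by (rule \<kappa>lc)
    qed
    show "\<phi> {u, v} \<noteq> \<phi> {v, x}" if "Q u v" "Q v x" "u \<noteq> x" for u v x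
      using that(1)
    proof (cases rule: Q_cases)
      case (1 i)
      have x: "x = g (Suc (Suc (Suc (Suc (Suc (Suc i))))))" using step(1) 1 that(2,3) by metis
      show ?thesis unfolding 1 x \<phi>C by (rule \<kappa>2)
    next
      case (2 i)
      have x: "x = g (Suc (Suc (Suc i)))" using step(2) 2 that(2,3) by metis
      show ?thesis unfolding 2 x \<phi>C' by (rule \<kappa>2[symmetric])
    qed
    show "\<not> (\<phi> {a, b} = \<phi> {c', d} \<and> \<phi> {b, c'} = \<phi> {d, e})"
      if h: "Q a b" "Q b c'" "Q c' d" "Q d e" "a \<noteq> c'" "b \<noteq> d" "c' \<noteq> e" for a b c' d e
      using h(1)
    proof (cases rule: Q_cases)
      case (1 i)
      have c: "c' = g (Suc (Suc (Suc (Suc (Suc (Suc i))))))" using step(1) 1 h(2,5) by metis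
      have d: "d = g (Suc (Suc (Suc (Suc (Suc (Suc (Suc i)))))))" using step(1) 1 c h(3,6) by metis
      have e: "e = g (Suc (Suc (Suc (Suc (Suc (Suc (Suc (Suc i))))))))" using step(1) c d h(4,7) by metis
      show ?thesis unfolding 1 c d e \<phi>C using \<kappa>4 by blast
    next
      case (2 i)
      have c: "c' = g (Suc (Suc (Suc i)))" using step(2) 2 h(2,5) by metis
      have d: "d = g (Suc (Suc i))" using step(2) 2 c h(3,6) by metis
      have e: "e = g (Suc i)" using step(2) c d h(4,7) by metis
      show ?thesis unfolding 2 c d e \<phi>C' using \<kappa>4[of i] by metis
    qed
  qed
  moreover have "\<phi> e \<in> L e" if "e \<in> edges (graph_union T C)" for e
  proof (cases "e \<in> cycle_edges cs")
    case True
    then obtain i where "e = {g i, g (Suc i)}" using edge_iff by blast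
    moreover from this have "Q (g i) (g (Suc i))" using True by (simp add: Q_def)
    ultimately show ?thesis
      by (elim Q_cases) (metis \<phi>C \<phi>C' \<kappa>L insert_commute)+
  next
    case False
    then show ?thesis using that cL by (simp add: \<phi>_def EH)
  qed
  ultimately show "\<exists>\<phi>. star_edge_coloring (graph_union T C) \<phi> \<and> (\<forall>e\<in>edges (graph_union T C). \<phi> e \<in> L e)"
    by blast
qed

end

text \<open>An edge is determined by the index of its first vertex, so one period of indices counts
  them. This turns the condition on the number of edges into one on the length of the list.\<close>

lemma card_cycle_edges:
  assumes "distinct cs" "length cs \<ge> 3"
  shows "card (cycle_edges cs) = length cs"
proof -
  interpret cyclic_list cs using assms by unfold_locales
  have "cycle_edges cs = (\<lambda>i. {g i, g (Suc i)}) ` {..<length cs}"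
  proof
    show "cycle_edges cs \<subseteq> (\<lambda>i. {g i, g (Suc i)}) ` {..<length cs}"
    proof
      fix e assume "e \<in> cycle_edges cs"
      then obtain i where e: "e = {g i, g (Suc i)}" using edge_iff by blast
      have "g i = g (i mod length cs)" by (simp add: g_eq_iff)
      then have "e = {g (i mod length cs), g (Suc (i mod length cs))}" using e edge_eq_iff by blast
      then show "e \<in> (\<lambda>i. {g i, g (Suc i)}) ` {..<length cs}" using n0 by auto
    qed
  qed (use edge_iff in blast)
  moreover have "inj_on (\<lambda>i. {g i, g (Suc i)}) {..<length cs}"
    by (auto simp: inj_on_def edge_eq_iff g_eq_iff)
  ultimately show ?thesis by (simp add: card_image)
qed

theorem theorem11:
  fixes T C H :: "'a graph"
    and p :: "'a \<Rightarrow> complex"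
    and \<gamma> :: "'a set \<Rightarrow> real \<Rightarrow> complex"
  assumes "generalized_halin T C p \<gamma>"
    and "H = graph_union T C"
    and "card (edges C) \<noteq> 5"
  shows "list_star_chromatic_index H
           \<le> max ((max_edge_degree_sum T + max_degree T) div 2) (2 * (max_degree T div 2) + 7)"
proof -
  obtain cs where cs: "distinct cs" "length cs \<ge> 3" "C = Graph (set cs) (cycle_edges cs)"
    using assms(1) by (auto simp: generalized_halin_def cycle_graph_def)
  then interpret halin cs T C p \<gamma>
    using assms(1) by unfold_locales
  have "length cs \<noteq> 5" using assms(3) cs(3) card_cycle_edges[OF cs(1,2)] by simp
  then show ?thesis
    unfolding list_star_chromatic_index_def assms(2)
    by (intro Least_le star_edge_choosable) simp_all
qed

end
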